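(* Let $G$ be a connected block graph which is not complete, with vertex weights $w: V(G)\to\mathbb{Z}^+$. Let $T$ be the block-cutpoint-tree of $G$, rooted at a cutpoint $r$ of $G$. Define functions $f_1,f_2,f_3$ on the nodes of $T$ bottom-up as follows (below $v$ denotes a node of $T$ that is a cutpoint of $G$ and $b$ a node that is a block of $G$; all leaves of $T$ are blocks): if $C(b)=\emptyset$, then $f_1(b)=s(b)$, $f_2(b)=0$, $f_3(b)=0$; otherwise $f_1(v) = w(v) + \sum_{b\in C(v)} f_2(b)$; $f_1(b) = s(b) + \sum_{v\in C(b)} f_1(v)$; if $|C(v)|\leq 2$ then $f_2(v) = \sum_{b\in C(v)} f_3(b)$, and if $|C(v)|\geq 3$ then $f_2(v) = \min_{b_1,b_2\in C(v)} \big(\sum_{b\in\{b_1,b_2\}} f_3(b) + \sum_{b\in C(v)\setminus\{b_1,b_2\}} f_1(b)\big)$; $f_2(b) = \min\Big\{ \sum_{v\in C(b)} \min\{f_1(v),f_3(v)\},\ \min_{v_1\in C(b)}\big(s(b) + f_2(v_1) + \sum_{v\in C(b)\setminus\{v_1\}} f_1(v)\big)\Big\}$; $f_3(b) = \sum_{v\in C(b)} \min\{f_1(v),f_3(v)\}$; if $C(v)=\{b\}$ then $f_3(v) = f_3(b)$, and if $|C(v)|\geq 2$ then $f_3(v) = \min_{b_1\in C(v)}\big(f_3(b_1) + \sum_{b\in C(v)\setminus\{b_1\}} f_1(b)\big)$. Then $f(r) = \min\{f_1(r), f_2(r)\}$ equals the minimum weight of a claw-deletion set of $G$.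
   Context: Graphs are finite, simple, undirected. A claw is $K_{1,3}$; a set $S\subseteq V(G)$ is a claw-deletion set of $G$ if the subgraph induced by $V(G)\setminus S$ has no induced $K_{1,3}$; its weight is $\sum_{u\in S} w(u)$. A cutpoint is a vertex whose removal increases the number of connected components; a block is a maximal 2-connected subgraph; a block graph is a graph in which every block is a clique. The block-cutpoint-tree of a connected graph $G$ is the bipartite graph whose vertices are the cutpoints and the blocks of $G$, a cutpoint being adjacent to a block when it belongs to it; it is a tree. For a node $x$ of the rooted tree $T$: $T_x$ is the subtree rooted at $x$, $C(x)$ its set of children, $p_T(x)$ its parent, and $T_x^+$ the subtree $T_x$ together with $p_T(x)$. For a node $x$, $G_x$ is the subgraph of $G$ induced by (the union of the vertex sets of) the blocks that are nodes of $T_x$; for a cutpoint $v\neq r$, $G_v^+$ is the subgraph of $G$ induced by the blocks that are nodes of $T_v^+$. For a block $b$, $G_b^- = G_b\setminus\{p_T(b)\}$, and $s(b)$ is the sum of the weights of the vertices of $b$ that are not cutpoints of $G$ ($s(b)=0$ if there are none). *)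

theory Defs
  imports "Graph_Theory.Graph_Theory"
begin

text \<open>
  Finite simple undirected graphs are the symmetric digraphs of the locale \<open>graph\<close>; an undirected
  edge is a pair of opposite arcs.
\<close>

abbreviation complete_graph :: "('a,'b) pre_digraph \<Rightarrow> bool" where
  "complete_graph G \<equiv> \<exists>n. complete_digraph n G"

text \<open>In a symmetric digraph, \<open>sccs\<close> is the set of connected components.\<close>

definition cutpoint :: "('a,'b) pre_digraph \<Rightarrow> 'a \<Rightarrow> bool" where
  "cutpoint G v \<longleftrightarrow> v \<in> verts G \<and>
     card (pre_digraph.sccs G) < card (pre_digraph.sccs (pre_digraph.del_vert G v))"

text \<open>
  As is usual when speaking of blocks, a single edge counts as 2-connected, so that bridges are
  blocks. The one-vertex graph is admitted as well, but it is a maximal such subgraph only if it is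
  an isolated vertex.
\<close>

definition two_connected :: "('a,'b) pre_digraph \<Rightarrow> bool" where
  "two_connected H \<longleftrightarrow> graph H \<and> Digraph_Component.connected H \<and> (\<forall>v. \<not> cutpoint H v)"

definition block :: "('a,'b) pre_digraph \<Rightarrow> ('a,'b) pre_digraph \<Rightarrow> bool" where
  "block G B \<longleftrightarrow> pre_digraph.max_subgraph G two_connected B"

definition block_graph :: "('a,'b) pre_digraph \<Rightarrow> bool" where
  "block_graph G \<longleftrightarrow> graph G \<and> (\<forall>B. block G B \<longrightarrow> complete_graph B)"

definition claw_deletion_set :: "('a,'b) pre_digraph \<Rightarrow> 'a set \<Rightarrow> bool" where
  "claw_deletion_set G S \<longleftrightarrow> S \<subseteq> verts G \<and>
     \<not> (\<exists>H. induced_subgraph H (G \<restriction> (verts G - S)) \<and> complete_bipartite_digraph 1 3 H)"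

datatype ('a,'b) bc_node = Cut 'a | Block "('a,'b) pre_digraph"

definition bc_tree :: "('a,'b) pre_digraph \<Rightarrow> ('a,'b) bc_node pair_pre_digraph" where
  "bc_tree G = \<lparr>
     pverts = Cut ` {v. cutpoint G v} \<union> Block ` {B. block G B},
     parcs = (\<Union>(v,B) \<in> {(v,B). cutpoint G v \<and> block G B \<and> v \<in> verts B}.
       {(Cut v, Block B), (Block B, Cut v)}) \<rparr>"

text \<open>\<open>x\<close> is the parent of \<open>y\<close> if it is the last but one node on the path from the root to \<open>y\<close>.\<close>

definition children :: "'n pair_pre_digraph \<Rightarrow> 'n \<Rightarrow> 'n \<Rightarrow> 'n set" where
  "children T r x = {y. \<exists>p. pre_digraph.apath (with_proj T) r (p @ [(x,y)]) y}"

definition noncut_weight :: "('a,'b) pre_digraph \<Rightarrow> ('a \<Rightarrow> nat) \<Rightarrow> ('a,'b) pre_digraph \<Rightarrow> nat" where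
  "noncut_weight G w B = (\<Sum>u\<in>{u \<in> verts B. \<not> cutpoint G u}. w u)"

context
  fixes G :: "('a,'b) pre_digraph" and w :: "'a \<Rightarrow> nat" and r :: 'a
begin

private abbreviation C :: "('a,'b) bc_node \<Rightarrow> ('a,'b) bc_node set" where
  "C \<equiv> children (bc_tree G) (Cut r)"

private abbreviation s :: "('a,'b) pre_digraph \<Rightarrow> nat" where
  "s \<equiv> noncut_weight G w"

text \<open>
  The recursion descends from a node to its children, so it is well-founded if \<open>bc_tree G\<close> is a
  finite tree, but not for arbitrary \<open>G\<close>. The functions are therefore left partial: the equations
  hold on the domain predicate generated by the function package.
\<close>

function (domintros) f1 f2 f3 :: "('a,'b) bc_node \<Rightarrow> nat" where
  "f1 (Cut v) = w v + (\<Sum>b\<in>C (Cut v). f2 b)"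
| "f1 (Block b) = (if C (Block b) = {} then s b else s b + (\<Sum>v\<in>C (Block b). f1 v))"
| "f2 (Cut v) =
    (if card (C (Cut v)) \<le> 2 then (\<Sum>b\<in>C (Cut v). f3 b)
     else (MIN b1\<in>C (Cut v). MIN b2\<in>C (Cut v).
             (\<Sum>b\<in>{b1,b2}. f3 b) + (\<Sum>b\<in>C (Cut v) - {b1,b2}. f1 b)))"
| "f2 (Block b) =
    (if C (Block b) = {} then 0
     else min (\<Sum>v\<in>C (Block b). min (f1 v) (f3 v))
              (MIN v1\<in>C (Block b). s b + f2 v1 + (\<Sum>v\<in>C (Block b) - {v1}. f1 v)))"
| "f3 (Cut v) =
    (if is_singleton (C (Cut v)) then f3 (the_elem (C (Cut v)))
     else (MIN b1\<in>C (Cut v). f3 b1 + (\<Sum>b\<in>C (Cut v) - {b1}. f1 b)))"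
| "f3 (Block b) =
    (if C (Block b) = {} then 0 else (\<Sum>v\<in>C (Block b). min (f1 v) (f3 v)))"
  by pat_completeness auto

end

end

theory Submission
  imports Defs
begin

text \<open>
  Every cycle of a block graph is 2-connected, hence lies in a block and is a clique; so the blocks
  are the maximal cliques. Order the vertices by their distance from \<open>r\<close>. Two vertices at the same
  distance that are joined by a path not coming closer to \<open>r\<close> lie with their parents on a cycle, so
  parents are unique and each block consists of one vertex, its apex, and vertices whose parent is
  the apex. This describes the block-cutpoint-tree rooted at \<open>r\<close>.

  A claw centred at \<open>v\<close> has its three leaves in three different blocks, so \<open>S\<close> is a claw-deletion
  set iff each vertex outside \<open>S\<close> lies in at most two blocks that contain another vertex outside \<open>S\<close>.
  This is a local condition, and for a subtree only the status of its top vertex, the number of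
  surviving child blocks and the survival of the block above matter. The feasible sets of each kind
  are therefore products of feasible sets in the subtrees below or unions of such products, and the
  minimum weight of a product is the sum of the minima.
\<close>

section \<open>Rooted block graphs\<close>

text \<open>Three values per node suffice because a surviving vertex has a budget of two surviving
  blocks: either both are child blocks, or one is the block above. The delicate place is a block
  whose apex is deleted. A member may then spend its whole budget on child blocks exactly when no
  other member survives, and this exception is the second term of the minimum defining
  \<open>f2\<close> at a block. The recursion has nodes for cutpoints only, whereas deletion sets
  contain arbitrary vertices. The families of sets are therefore defined at every vertex; a vertex
  without child blocks costs its weight if deleted and 0 if kept, and it is the sum of these weights
  that the recursion calls \<open>s\<close>. The combinatorial part uses only the adjacency relation
  and the fact that cycles are cliques, so it runs over a bare relation. Arcs, blocks as subgraphs,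
  paths in the tree and the partiality of \<open>f1\<close>, \<open>f2\<close>, \<open>f3\<close>
  stay out of it and are related to it separately.\<close>

abbreviation is_path :: "('a \<times> 'a) set \<Rightarrow> 'a list \<Rightarrow> bool" where
  "is_path E \<equiv> successively (\<lambda>x y. (x, y) \<in> E)"

text \<open>\<open>E \<inter> W \<times> W\<close> stands for moving inside the subgraph induced by
  \<open>W\<close>. The path grows edge by edge; on a return to a visited vertex it is cut back to
  that vertex, which keeps it distinct.\<close>

lemma rtrancl_imp_distinct_path:
  assumes "(x, y) \<in> (E \<inter> W \<times> W)\<^sup>*" "x \<in> W"
  obtains xs where "xs \<noteq> []" "hd xs = x" "last xs = y" "distinct xs" "set xs \<subseteq> W" "is_path E xs"
proof -
  have "\<exists>xs. xs \<noteq> [] \<and> hd xs = x \<and> last xs = y \<and> distinct xs \<and> set xs \<subseteq> W \<and> is_path E xs"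
    using assms(1)
  proof induction
    case base
    show ?case using assms(2) by (intro exI[of _ "[x]"]) auto
  next
    case (step y z)
    then obtain xs where xs: "xs \<noteq> []" "hd xs = x" "last xs = y" "distinct xs" "set xs \<subseteq> W"
      "is_path E xs" by blast
    show ?case
    proof (cases "z \<in> set xs")
      case True
      then obtain as bs where "xs = as @ z # bs" by (auto simp: in_set_conv_decomp)
      with xs show ?thesis
        by (intro exI[of _ "as @ [z]"]) (auto simp: successively_append_iff hd_append split: if_splits)
    next
      case False
      with xs step show ?thesis
        by (intro exI[of _ "xs @ [z]"]) (auto simp: successively_append_iff)
    qed
  qed
  then show ?thesis using that by blast
qed

lemma path_imp_rtrancl:
  assumes "is_path E xs" "sym E" "set xs \<subseteq> W" "x \<in> set xs" "y \<in> set xs"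
  shows "(x, y) \<in> (E \<inter> W \<times> W)\<^sup>*"
proof -
  have "\<forall>z\<in>set xs. (hd xs, z) \<in> (E \<inter> W \<times> W)\<^sup>*" using assms(1,3)
  proof (induction xs)
    case (Cons a xs)
    show ?case
    proof (cases "xs = []")
      case False
      then have "(a, hd xs) \<in> E \<inter> W \<times> W" using Cons.prems by (cases xs) auto
      then show ?thesis using Cons False
        by (auto simp: successively_Cons intro: converse_rtrancl_into_rtrancl)
    qed auto
  qed auto
  moreover have "sym ((E \<inter> W \<times> W)\<^sup>*)"
    using assms(2) by (intro sym_rtrancl) (auto simp: sym_def)
  ultimately show ?thesis using assms(4,5) by (meson rtrancl_trans symD)
qed

text \<open>Blocks and 2-connectedness are left out on purpose: they enter only through
  \<open>cycle_clique\<close>, from which levels, parents and maximal cliques are developed.\<close>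

locale rooted_block_graph =
  fixes V :: "'a set" and E :: "('a \<times> 'a) set" and r :: 'a
  assumes finite_V: "finite V" and E_sub: "E \<subseteq> V \<times> V" and sym_E: "sym E"
    and irrefl_E: "(x, x) \<notin> E" and r_in: "r \<in> V" and reach: "v \<in> V \<Longrightarrow> (r, v) \<in> E\<^sup>*"
    and cycle_clique: "\<lbrakk>distinct xs; 3 \<le> length xs; is_path E xs; (last xs, hd xs) \<in> E;
      x \<in> set xs; y \<in> set xs; x \<noteq> y\<rbrakk> \<Longrightarrow> (x, y) \<in> E"
begin

lemma E_commute: "(x, y) \<in> E \<longleftrightarrow> (y, x) \<in> E"
  using sym_E by (auto dest: symD)

lemma E_in_V: "(x, y) \<in> E \<Longrightarrow> x \<in> V" "(x, y) \<in> E \<Longrightarrow> y \<in> V"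
  using E_sub by auto

lemma E_neq: "(x, y) \<in> E \<Longrightarrow> x \<noteq> y"
  using irrefl_E by auto

section \<open>Distance from the root and parents\<close>

definition lev :: "'a \<Rightarrow> nat" where
  "lev u = (LEAST n. (r, u) \<in> E ^^ n)"

lemma lev_relpow: "v \<in> V \<Longrightarrow> (r, v) \<in> E ^^ lev v"
  unfolding lev_def by (rule LeastI_ex) (use reach rtrancl_imp_relpow in blast)

lemma lev_le: "(r, v) \<in> E ^^ n \<Longrightarrow> lev v \<le> n"
  unfolding lev_def by (rule Least_le)

lemma lev_r [simp]: "lev r = 0"
  using lev_le[of r 0] by auto

lemma lev_eq_0_iff: "v \<in> V \<Longrightarrow> lev v = 0 \<longleftrightarrow> v = r"
  using lev_relpow[of v] by auto

lemma lev_step: "(u, v) \<in> E \<Longrightarrow> lev v \<le> Suc (lev u)"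
  using lev_relpow[OF E_in_V(1)] by (intro lev_le relpow_Suc_I)

lemma parent_exists:
  assumes "u \<in> V" "u \<noteq> r"
  obtains p where "(p, u) \<in> E" "lev u = Suc (lev p)"
proof -
  obtain n where n: "lev u = Suc n"
    using assms lev_eq_0_iff by (metis not0_implies_Suc)
  then obtain p where p: "(r, p) \<in> E ^^ n" "(p, u) \<in> E" using lev_relpow[OF assms(1)] by auto
  have "lev u = Suc (lev p)"
    using lev_le[OF p(1)] lev_step[OF p(2)] n by simp
  with p(2) show ?thesis by (rule that)
qed

text \<open>Passing from a vertex to a parent lowers the level, so the walk to \<open>r\<close>
  stays within the levels up to \<open>n\<close>. It supplies the lower half of the cycle in
  \<open>level_cycle\<close>.\<close>

lemma low_reach:
  assumes "v \<in> V" "lev v \<le> n"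
  shows "(v, r) \<in> (E \<inter> {u\<in>V. lev u \<le> n} \<times> {u\<in>V. lev u \<le> n})\<^sup>*"
  using assms
proof (induction "lev v" arbitrary: v)
  case 0
  then show ?case using lev_eq_0_iff by auto
next
  case (Suc k)
  then have "v \<noteq> r" by auto
  then obtain p where "(p, v) \<in> E" "lev v = Suc (lev p)" using parent_exists Suc.prems by metis
  with Suc show ?case
    by (intro converse_rtrancl_into_rtrancl[of v p]) (auto simp: E_commute dest: E_in_V)
qed

text \<open>Parents of the two ends of \<open>xs\<close> lie just below level \<open>n\<close> and
  are joined through the root without rising above their level. This return path misses
  \<open>xs\<close> by levels, so the two together form a cycle and hence a clique. Being neighbours
  of \<open>p\<close>, the vertices of \<open>xs\<close> are forced down to level
  \<open>n\<close>.\<close>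

lemma level_cycle:
  assumes xs: "distinct xs" "is_path E xs" "set xs \<subseteq> {u\<in>V. n \<le> lev u}" "hd xs \<noteq> last xs" "xs \<noteq> []"
    and lev: "lev (hd xs) = n" "lev (last xs) = n"
    and p: "(p, hd xs) \<in> E" "n = Suc (lev p)"
  shows "u \<in> set xs \<Longrightarrow> (p, u) \<in> E" "u \<in> set xs \<Longrightarrow> lev u = n" "(hd xs, last xs) \<in> E"
proof -
  have last_in: "last xs \<in> set xs" "hd xs \<in> set xs" using xs by auto
  have "last xs \<in> V" using last_in xs(3) by auto
  moreover have "last xs \<noteq> r" using lev p by (metis lev_r nat.distinct(1))
  ultimately obtain q where q: "(q, last xs) \<in> E" "lev (last xs) = Suc (lev q)" using parent_exists by metis
  let ?W = "{u\<in>V. lev u \<le> lev p}"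
  have "lev q = lev p" using q p lev by auto
  then have "(q, r) \<in> (E \<inter> ?W \<times> ?W)\<^sup>*" "(p, r) \<in> (E \<inter> ?W \<times> ?W)\<^sup>*"
    using low_reach E_in_V q(1) p(1) by auto
  moreover have "sym ((E \<inter> ?W \<times> ?W)\<^sup>*)"
    using sym_E by (intro sym_rtrancl) (auto simp: sym_def)
  ultimately have "(q, p) \<in> (E \<inter> ?W \<times> ?W)\<^sup>*" by (meson rtrancl_trans symD)
  moreover have "q \<in> ?W" using q p lev E_in_V by auto
  ultimately obtain ys where ys: "ys \<noteq> []" "hd ys = q" "last ys = p" "distinct ys" "set ys \<subseteq> ?W"
    "is_path E ys" by (rule rtrancl_imp_distinct_path)
  \<comment> \<open>The distinct ends give two vertices, so a single vertex in \<open>ys\<close>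
    already makes a cycle; this covers ends with a common parent.\<close>
  have len: "2 \<le> length xs" using xs(4,5) by (cases xs; cases "tl xs") auto
  have cyc: "distinct (xs @ ys)" "3 \<le> length (xs @ ys)" "is_path E (xs @ ys)"
    "(last (xs @ ys), hd (xs @ ys)) \<in> E"
  proof -
    have "set xs \<inter> set ys = {}" using xs(3) ys(5) p(2) by fastforce
    then show "distinct (xs @ ys)" using xs(1) ys(4) by auto
    show "3 \<le> length (xs @ ys)" using len ys(1) by (cases ys) auto
    show "is_path E (xs @ ys)" using xs ys q(1) by (auto simp: successively_append_iff E_commute)
    show "(last (xs @ ys), hd (xs @ ys)) \<in> E" using xs(5) ys p(1) by auto
  qed
  have p_in: "p \<in> set ys" using ys by auto
  show pu: "(p, u) \<in> E" if "u \<in> set xs" for u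
    using cycle_clique[OF cyc, of p u] that p_in cyc(1) by auto
  show "lev u = n" if "u \<in> set xs"
    using lev_step[OF pu[OF that]] that xs(3) p by auto
  show "(hd xs, last xs) \<in> E"
    using cycle_clique[OF cyc, of "hd xs" "last xs"] last_in xs by auto
qed

text \<open>Two parents would be the ends of the path \<open>[p, u, q]\<close>, which never drops
  below their level. By \<open>level_cycle\<close> it lies in one level, yet \<open>u\<close> is one
  higher.\<close>

lemma parent_unique:
  assumes "(p, u) \<in> E" "lev u = Suc (lev p)" "(q, u) \<in> E" "lev u = Suc (lev q)"
  shows "p = q"
proof (rule ccontr)
  assume "p \<noteq> q"
  have V: "p \<in> V" "q \<in> V" "u \<in> V" "u \<noteq> p" "u \<noteq> q" using assms E_in_V E_neq by blast+
  have "p \<noteq> r"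
  proof
    assume "p = r"
    then have "lev q = 0" using assms by simp
    then show False using \<open>p \<noteq> q\<close> \<open>p = r\<close> lev_eq_0_iff[OF V(2)] by simp
  qed
  then obtain p' where p': "(p', p) \<in> E" "lev p = Suc (lev p')"
    using parent_exists V(1) by blast
  have "(u, q) \<in> E" using assms(3) E_commute by blast
  then have "lev u = lev p"
    using level_cycle(2)[of "[p,u,q]" "lev p" p' u] p' assms V \<open>p \<noteq> q\<close> by simp
  with assms show False by simp
qed

definition par :: "'a \<Rightarrow> 'a" where
  "par u = (THE p. (p, u) \<in> E \<and> lev u = Suc (lev p))"

lemma parI:
  assumes "(p, u) \<in> E" "lev u = Suc (lev p)"
  shows "par u = p"
  unfolding par_def
proof (rule the_equality)
  show "q = p" if "(q, u) \<in> E \<and> lev u = Suc (lev q)" for q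
    using parent_unique[of q u p] that assms by simp
qed (use assms in simp)

lemma
  assumes "u \<in> V" "u \<noteq> r"
  shows par_edge: "(par u, u) \<in> E" and lev_par: "lev u = Suc (lev (par u))"
proof -
  obtain p where p: "(p, u) \<in> E" "lev u = Suc (lev p)" using parent_exists[OF assms] .
  show "(par u, u) \<in> E" "lev u = Suc (lev (par u))" unfolding parI[OF p] using p by simp_all
qed

lemma par_in_V: "u \<in> V \<Longrightarrow> u \<noteq> r \<Longrightarrow> par u \<in> V"
  using E_in_V(1)[OF par_edge] .

text \<open>The edge is itself a path within one level, so \<open>level_cycle\<close> makes the
  parent of \<open>x\<close> adjacent to \<open>y\<close>.\<close>

lemma edge_same_level:
  assumes "(x, y) \<in> E" "lev x = lev y"
  shows "x \<noteq> r" "par y = par x"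
proof -
  have V: "x \<noteq> y" "x \<in> V" "y \<in> V"
    using E_neq[OF assms(1)] E_in_V[OF assms(1)] by auto
  show "x \<noteq> r"
  proof
    assume "x = r"
    then have "lev y = 0" using assms by simp
    then show False using lev_eq_0_iff[OF V(3)] V(1) \<open>x = r\<close> by simp
  qed
  then have "(par x, y) \<in> E"
    using level_cycle(1)[of "[x,y]" "lev x" "par x" y] assms par_edge lev_par V by simp
  then show "par y = par x" using lev_par[OF V(2) \<open>x \<noteq> r\<close>] assms by (intro parI) simp_all
qed

lemma edge_same_level_trans:
  assumes "(x, y) \<in> E" "(y, z) \<in> E" "lev x = lev y" "lev z = lev y" "x \<noteq> z"
  shows "(x, z) \<in> E"
proof -
  have V: "x \<noteq> y" "y \<noteq> z" "x \<in> V" "y \<in> V" "z \<in> V"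
    using E_neq[OF assms(1)] E_in_V[OF assms(1)] E_neq[OF assms(2)] E_in_V[OF assms(2)] by auto
  have "x \<noteq> r" using edge_same_level(1)[OF assms(1,3)] .
  then show ?thesis
    using level_cycle(3)[of "[x,y,z]" "lev x" "par x"] assms par_edge lev_par V by simp
qed

section \<open>Maximal cliques, their apex, and the clique above a vertex\<close>

definition clique :: "'a set \<Rightarrow> bool" where
  "clique K \<longleftrightarrow> K \<subseteq> V \<and> (\<forall>x\<in>K. \<forall>y\<in>K. x \<noteq> y \<longrightarrow> (x, y) \<in> E)"

definition max_clique :: "'a set \<Rightarrow> bool" where
  "max_clique K \<longleftrightarrow> clique K \<and> (\<forall>K'. clique K' \<and> K \<subseteq> K' \<longrightarrow> K' = K)"

lemma max_clique_edge: "max_clique K \<Longrightarrow> x \<in> K \<Longrightarrow> y \<in> K \<Longrightarrow> x \<noteq> y \<Longrightarrow> (x, y) \<in> E"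
  and max_clique_sub: "max_clique K \<Longrightarrow> K \<subseteq> V"
  unfolding max_clique_def clique_def by auto

lemma max_clique_absorb:
  assumes "max_clique K" "v \<in> V" "\<And>x. x \<in> K \<Longrightarrow> x \<noteq> v \<Longrightarrow> (v, x) \<in> E"
  shows "v \<in> K"
proof -
  have "clique (insert v K)" using assms unfolding max_clique_def clique_def
    by (auto simp: E_commute)
  then show ?thesis using assms(1) unfolding max_clique_def by blast
qed

lemma finite_max_clique: "max_clique K \<Longrightarrow> finite K"
  using max_clique_sub finite_V finite_subset by blast

lemma finite_max_cliques: "finite {K. max_clique K}"
  by (rule finite_subset[of _ "Pow V"]) (use max_clique_sub finite_V in auto)

lemma clique_extend:
  assumes "clique K"
  obtains K' where "max_clique K'" "K \<subseteq> K'"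
proof -
  have "finite {K. clique K}"
    by (rule finite_subset[of _ "Pow V"]) (auto simp: clique_def finite_V)
  then obtain K' where "K' \<in> {K. clique K}" "K \<subseteq> K'" "\<forall>L\<in>{K. clique K}. K' \<subseteq> L \<longrightarrow> K' = L"
    using finite_has_maximal2[of "{K. clique K}" K] assms by blast
  then show ?thesis using that unfolding max_clique_def by blast
qed

lemma edge_max_clique:
  assumes "(x, y) \<in> E"
  obtains K where "max_clique K" "x \<in> K" "y \<in> K"
proof -
  have "clique {x, y}"
    using assms E_in_V[OF assms] E_commute[of x y] unfolding clique_def by simp
  then obtain K where "max_clique K" "{x, y} \<subseteq> K" by (rule clique_extend)
  then show ?thesis using that by simp
qed

text \<open>Take \<open>p\<close> of least level in \<open>K\<close>. If some other \<open>u\<close>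
  shared this level, a vertex of \<open>K\<close> one level higher would have the two parents
  \<open>p\<close> and \<open>u\<close>, so all of \<open>K\<close> would lie in one level. Then
  \<open>par p\<close> is adjacent to all of \<open>K\<close> and is absorbed by maximality,
  although its level is lower.\<close>

lemma max_clique_root:
  assumes K: "max_clique K"
  shows "\<exists>p\<in>K. (\<forall>u\<in>K - {p}. u \<noteq> r \<and> lev u = Suc (lev p) \<and> par u = p)"
proof -
  have "K \<noteq> {}" using K max_clique_absorb[OF K r_in] by auto
  then obtain p where p: "p \<in> K" "\<And>u. u \<in> K \<Longrightarrow> lev p \<le> lev u"
    using ex_has_least_nat[of "\<lambda>u. u \<in> K" _ lev] by auto
  have KV: "K \<subseteq> V" using max_clique_sub[OF K] .
  have "lev u = Suc (lev p)" if u: "u \<in> K" "u \<noteq> p" for u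
  proof (rule ccontr)
    assume neq: "lev u \<noteq> Suc (lev p)"
    have pu: "(p, u) \<in> E" using max_clique_edge[OF K] p(1) u by auto
    have lu: "lev u = lev p" using lev_step[OF pu] p(2)[OF u(1)] neq by simp
    have pr: "p \<noteq> r" using edge_same_level(1)[OF pu] lu by simp
    have pV: "p \<in> V" using p KV by auto
    have same: "lev x = lev p" if x: "x \<in> K" for x
    proof (rule ccontr)
      assume "lev x \<noteq> lev p"
      then have "x \<noteq> p" "x \<noteq> u" using lu by auto
      then have e: "(p, x) \<in> E" "(u, x) \<in> E" using max_clique_edge[OF K] x u p by auto
      then have "lev x = Suc (lev p)" using lev_step[OF e(1)] p(2)[OF x] \<open>lev x \<noteq> lev p\<close> by simp
      then show False using parent_unique[OF e(1) _ e(2)] lu u by simp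
    qed
    have "(par p, x) \<in> E" if "x \<in> K" for x
    proof (cases "x = p")
      case True
      then show ?thesis using par_edge[OF pV pr] by simp
    next
      case False
      then have e: "(p, x) \<in> E" using max_clique_edge[OF K] p that by auto
      then have "x \<in> V" "x \<noteq> r" "par x = par p"
        using edge_same_level[OF e] edge_same_level(1)[of x p] same[OF that] E_in_V[OF e] E_commute[of x p]
        by simp_all
      then show ?thesis using par_edge[of x] by simp
    qed
    then have "par p \<in> K" using max_clique_absorb[OF K par_in_V[OF pV pr]] by auto
    then show False using same[of "par p"] lev_par[OF pV pr] by simp
  qed
  moreover have "par u = p" if "u \<in> K" "u \<noteq> p" for u
    using that p(1) max_clique_edge[OF K] calculation by (intro parI) simp_all
  moreover have "u \<noteq> r" if "u \<in> K" "u \<noteq> p" for u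
    using calculation(1)[OF that] by (metis lev_r nat.distinct(1))
  ultimately show ?thesis using p(1) by (intro bexI[of _ p]) auto
qed

text \<open>Levels alone determine this vertex: of two candidates, each would lie one level above
  the other. In the tree it is the parent of the block.\<close>

definition apex :: "'a set \<Rightarrow> 'a" where
  "apex K = (THE p. p \<in> K \<and> (\<forall>u\<in>K - {p}. lev u = Suc (lev p)))"

lemma
  assumes K: "max_clique K"
  shows apex_in: "apex K \<in> K" and lev_apex: "u \<in> K \<Longrightarrow> u \<noteq> apex K \<Longrightarrow> lev u = Suc (lev (apex K))"
    and par_apex: "u \<in> K \<Longrightarrow> u \<noteq> apex K \<Longrightarrow> par u = apex K"
    and root_apex: "r \<in> K \<Longrightarrow> apex K = r"
proof -
  obtain p where p: "p \<in> K" "\<forall>u\<in>K - {p}. u \<noteq> r \<and> lev u = Suc (lev p) \<and> par u = p"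
    using max_clique_root[OF K] by auto
  have "apex K = p" unfolding apex_def
  proof (rule the_equality)
    show "q = p" if q: "q \<in> K \<and> (\<forall>u\<in>K - {q}. lev u = Suc (lev q))" for q
    proof (rule ccontr)
      assume "q \<noteq> p"
      have "lev q = Suc (lev p)" using p(2) q \<open>q \<noteq> p\<close> by blast
      moreover have "lev p = Suc (lev q)" using p(1) q \<open>q \<noteq> p\<close> by blast
      ultimately show False by simp
    qed
  qed (use p in simp)
  with p show "apex K \<in> K" "u \<in> K \<Longrightarrow> u \<noteq> apex K \<Longrightarrow> lev u = Suc (lev (apex K))"
    "u \<in> K \<Longrightarrow> u \<noteq> apex K \<Longrightarrow> par u = apex K" "r \<in> K \<Longrightarrow> apex K = r" by auto
qed

text \<open>The block above \<open>u\<close>, written without cliques: for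
  \<open>u \<noteq> r\<close> it turns out to be the only maximal clique in which \<open>u\<close>
  is not the apex. At \<open>r\<close> it means nothing, hence the later case distinctions on
  \<open>v = r\<close>.\<close>

definition home :: "'a \<Rightarrow> 'a set" where
  "home u = {par u, u} \<union> {x. (u, x) \<in> E \<and> lev x = lev u}"

text \<open>Levels and parents put \<open>K\<close> inside \<open>home u\<close>. Conversely a
  neighbour of \<open>u\<close> at the same level has the same parent and, by
  \<open>edge_same_level_trans\<close>, is adjacent to the rest of \<open>K\<close>, so maximality
  absorbs it.\<close>

lemma home_eqI:
  assumes K: "max_clique K" and u: "u \<in> K" "u \<noteq> apex K"
  shows "home u = K"
proof -
  have uV: "u \<in> V" "u \<noteq> r" using max_clique_sub[OF K] u root_apex[OF K] by auto
  have sub: "K \<subseteq> home u"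
  proof
    fix x assume x: "x \<in> K"
    consider "x = apex K" | "x = u" | "x \<noteq> apex K" "x \<noteq> u" by auto
    then show "x \<in> home u"
      using par_apex[OF K u] lev_apex[OF K] u x max_clique_edge[OF K u(1) x]
      by cases (auto simp: home_def)
  qed
  have "x \<in> K" if x: "(u, x) \<in> E" "lev x = lev u" for x
  proof (rule max_clique_absorb[OF K])
    show "x \<in> V" using E_in_V[OF x(1)] by simp
    fix y assume y: "y \<in> K" "y \<noteq> x"
    consider "y = apex K" | "y = u" | "y \<noteq> apex K" "y \<noteq> u" by auto
    then show "(x, y) \<in> E"
    proof cases
      case 1
      have "par x = y" using edge_same_level(2)[OF x(1)] x(2) par_apex[OF K u] 1 by simp
      moreover have "x \<noteq> r" using edge_same_level(1)[of x u] x E_commute[of x u] by simp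
      ultimately show ?thesis using par_edge[OF \<open>x \<in> V\<close>] E_commute[of x y] by simp
    next
      case 2
      then show ?thesis using x E_commute[of x u] by simp
    next
      case 3
      have "(u, y) \<in> E" "lev y = lev u" using max_clique_edge[OF K u(1)] y 3 lev_apex[OF K] u by auto
      then show ?thesis using edge_same_level_trans[of x u y] x y E_commute[of x u] by simp
    qed
  qed
  then have "home u \<subseteq> K"
    using apex_in[OF K] par_apex[OF K u] u by (auto simp: home_def)
  with sub show ?thesis by auto
qed

lemma
  assumes "u \<in> V" "u \<noteq> r"
  shows home_max_clique: "max_clique (home u)" and apex_home: "apex (home u) = par u"
    and in_home: "u \<in> home u"
proof -
  obtain K where K: "max_clique K" "par u \<in> K" "u \<in> K"
    using edge_max_clique[OF par_edge[OF assms]] .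
  have "u \<noteq> apex K"
    using lev_apex[OF K(1,2)] lev_par[OF assms] by (cases "par u = apex K") auto
  then have "home u = K" "apex K = par u" using home_eqI[OF K(1,3)] par_apex[OF K(1,3)] by auto
  with K show "max_clique (home u)" "apex (home u) = par u" "u \<in> home u" by auto
qed

text \<open>By levels, \<open>u\<close> and \<open>v\<close> cannot be the apexes of
  \<open>K\<close> and \<open>L\<close> crosswise. So one of them is the apex of neither, and its
  \<open>home\<close> equals both cliques.\<close>

lemma max_clique_share:
  assumes K: "max_clique K" and L: "max_clique L" and "u \<in> K" "u \<in> L" "v \<in> K" "v \<in> L" "u \<noteq> v"
  shows "K = L"
proof -
  have "\<not> (x = apex K \<and> y = apex L)" if "x \<in> K" "x \<in> L" "y \<in> K" "y \<in> L" "x \<noteq> y" for x y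
  proof
    assume *: "x = apex K \<and> y = apex L"
    have "lev y = Suc (lev x)" using lev_apex[OF K that(3)] that * by metis
    moreover have "lev x = Suc (lev y)" using lev_apex[OF L that(2)] that * by metis
    ultimately show False by simp
  qed
  note this[of u v] this[of v u]
  with assms have "u \<noteq> apex K \<and> u \<noteq> apex L \<or> v \<noteq> apex K \<and> v \<noteq> apex L" by metis
  then show ?thesis using home_eqI[OF K] home_eqI[OF L] assms by metis
qed

lemma max_cliques_at:
  assumes "v \<in> V"
  shows "{K. max_clique K \<and> v \<in> K} =
    {K. max_clique K \<and> apex K = v} \<union> (if v = r then {} else {home v})"
proof (intro set_eqI iffI)
  fix K assume "K \<in> {K. max_clique K \<and> v \<in> K}"
  then show "K \<in> {K. max_clique K \<and> apex K = v} \<union> (if v = r then {} else {home v})"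
    using home_eqI[of K v] root_apex[of K] by auto
next
  fix K assume "K \<in> {K. max_clique K \<and> apex K = v} \<union> (if v = r then {} else {home v})"
  then show "K \<in> {K. max_clique K \<and> v \<in> K}"
    using apex_in[of K] home_max_clique[OF assms] in_home[OF assms] by (auto split: if_splits)
qed

lemma home_not_child:
  assumes "v \<in> V" "v \<noteq> r"
  shows "apex (home v) \<noteq> v"
  using apex_home[OF assms] E_neq[OF par_edge[OF assms]] by simp

text \<open>A path between vertices of two cliques through \<open>v\<close> that avoids \<open>v\<close> would close up to a cycle
  through \<open>v\<close>.\<close>

lemma two_cliques_separate:
  assumes K: "max_clique K" "max_clique L" "K \<noteq> L" "v \<in> K" "v \<in> L"
  shows "\<exists>x\<in>V - {v}. \<exists>y\<in>V - {v}. (x, y) \<notin> (E \<inter> (V - {v}) \<times> (V - {v}))\<^sup>*"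
proof -
  obtain y where y: "y \<in> L" "y \<notin> K" using K unfolding max_clique_def by blast
  have yV: "y \<in> V" "y \<noteq> v" using y K max_clique_sub by auto
  then obtain x where x: "x \<in> K" "x \<noteq> y" "(y, x) \<notin> E" using max_clique_absorb[OF K(1)] y by blast
  have vy: "(v, y) \<in> E" using max_clique_edge[OF K(2)] K y by auto
  have xv: "x \<noteq> v" using x vy E_commute[of y v] by auto
  have vx: "(v, x) \<in> E" "x \<in> V" using max_clique_edge[OF K(1)] max_clique_sub[OF K(1)] K x xv by auto
  have "(x, y) \<notin> (E \<inter> (V - {v}) \<times> (V - {v}))\<^sup>*"
  proof
    assume "(x, y) \<in> (E \<inter> (V - {v}) \<times> (V - {v}))\<^sup>*"
    moreover have "x \<in> V - {v}" using vx xv by auto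
    ultimately obtain xs where xs: "xs \<noteq> []" "hd xs = x" "last xs = y" "distinct xs" "set xs \<subseteq> V - {v}"
      "is_path E xs" by (rule rtrancl_imp_distinct_path)
    have "2 \<le> length xs" using xs x by (cases xs; cases "tl xs") auto
    moreover have "x \<in> set xs" "y \<in> set xs" using xs by auto
    moreover have "is_path E (v # xs)" using xs(1,2,6) vx(1) by (simp add: successively_Cons)
    moreover have "(last (v # xs), hd (v # xs)) \<in> E" using xs(1,3) vy E_commute[of y v] by simp
    moreover have "distinct (v # xs)" using xs(4,5) by auto
    ultimately have "(x, y) \<in> E" using cycle_clique[of "v # xs" x y] x(2) by simp
    then show False using x E_commute[of x y] by simp
  qed
  then show ?thesis using vx xv yV by blast
qed

text \<open>A path through \<open>v\<close> enters and leaves it within the same clique, so the two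
  neighbours of \<open>v\<close> on the path are adjacent and \<open>v\<close> can be
  bypassed.\<close>

lemma one_clique_connected:
  assumes one: "\<And>K L. max_clique K \<Longrightarrow> max_clique L \<Longrightarrow> v \<in> K \<Longrightarrow> v \<in> L \<Longrightarrow> K = L"
    and xy: "x \<in> V - {v}" "y \<in> V - {v}"
  shows "(x, y) \<in> (E \<inter> (V - {v}) \<times> (V - {v}))\<^sup>*"
proof -
  have "sym (E\<^sup>*)" using sym_E by (rule sym_rtrancl)
  then have "(x, y) \<in> E\<^sup>*" using reach xy by (meson DiffD1 rtrancl_trans symD)
  moreover have "E \<inter> V \<times> V = E" using E_sub by auto
  ultimately obtain xs where xs: "xs \<noteq> []" "hd xs = x" "last xs = y" "distinct xs" "set xs \<subseteq> V"
    "is_path E xs" using rtrancl_imp_distinct_path[of x y E V] xy by auto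
  have xin: "x \<in> set xs" "y \<in> set xs" using xs by auto
  show ?thesis
  proof (cases "v \<in> set xs")
    case False
    then show ?thesis using xs(5) by (intro path_imp_rtrancl[OF xs(6) sym_E _ xin]) auto
  next
    case True
    then obtain as bs where ab: "xs = as @ v # bs" by (auto simp: in_set_conv_decomp)
    have ne: "as \<noteq> []" "bs \<noteq> []" using xs ab xy by auto
    have e: "(last as, v) \<in> E" "(v, hd bs) \<in> E"
      using xs(6) ne unfolding ab by (auto simp: successively_append_iff successively_Cons)
    obtain K where K: "max_clique K" "last as \<in> K" "v \<in> K" using edge_max_clique[OF e(1)] .
    obtain L where L: "max_clique L" "v \<in> L" "hd bs \<in> L" using edge_max_clique[OF e(2)] .
    have "last as \<in> set as" "hd bs \<in> set bs" using ne by auto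
    then have "last as \<noteq> hd bs" using xs(4) ab by auto
    then have "(last as, hd bs) \<in> E" using max_clique_edge K L one by metis
    then have "is_path E (as @ bs)" using xs(6) ne unfolding ab
      by (auto simp: successively_append_iff successively_Cons)
    then show ?thesis
      by (rule path_imp_rtrancl[OF _ sym_E]) (use xs xin xy ab in auto)
  qed
qed

text \<open>Leaves of a claw are pairwise nonadjacent, so the cliques joining them to the centre
  differ. Conversely one survivor from each of three cliques serves as a leaf: an edge between two
  of them would span with \<open>c\<close> a clique that shares two vertices with each of their
  cliques, against \<open>max_clique_share\<close>.\<close>

lemma claw_iff_three_cliques:
  assumes "U \<subseteq> V"
  shows "(\<exists>c\<in>U. \<exists>A\<subseteq>U. card A = 3 \<and> (\<forall>a\<in>A. (c, a) \<in> E) \<and> (\<forall>a\<in>A. \<forall>b\<in>A. (a, b) \<notin> E)) \<longleftrightarrow>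
    (\<exists>c\<in>U. 3 \<le> card {K. max_clique K \<and> c \<in> K \<and> (K - {c}) \<inter> U \<noteq> {}})"
proof (intro bex_cong refl iffI)
  fix c assume c: "c \<in> U"
  let ?Q = "{K. max_clique K \<and> c \<in> K \<and> (K - {c}) \<inter> U \<noteq> {}}"
  have fin: "finite ?Q" using finite_max_cliques by (rule rev_finite_subset) auto
  {
    assume "\<exists>A\<subseteq>U. card A = 3 \<and> (\<forall>a\<in>A. (c, a) \<in> E) \<and> (\<forall>a\<in>A. \<forall>b\<in>A. (a, b) \<notin> E)"
    then obtain A where A: "A \<subseteq> U" "card A = 3" "\<And>a. a \<in> A \<Longrightarrow> (c, a) \<in> E"
      "\<And>a b. a \<in> A \<Longrightarrow> b \<in> A \<Longrightarrow> (a, b) \<notin> E" by blast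
    have "\<forall>a\<in>A. \<exists>K. max_clique K \<and> c \<in> K \<and> a \<in> K" using A(3) edge_max_clique by metis
    then obtain k where k: "\<And>a. a \<in> A \<Longrightarrow> max_clique (k a) \<and> c \<in> k a \<and> a \<in> k a" by metis
    have "inj_on k A" using k A(4) max_clique_edge by (intro inj_onI) metis
    moreover have "k ` A \<subseteq> ?Q"
    proof
      fix K assume "K \<in> k ` A"
      then obtain a where "a \<in> A" "K = k a" by auto
      moreover have "a \<noteq> c" using E_neq[OF A(3)[OF \<open>a \<in> A\<close>]] by simp
      ultimately show "K \<in> ?Q" using k A(1) by auto
    qed
    ultimately show "3 \<le> card ?Q" using A(2) card_inj_on_le[of k A ?Q] fin by auto
  next
    assume "3 \<le> card ?Q"
    then obtain Q where Q: "Q \<subseteq> ?Q" "card Q = 3" by (meson obtain_subset_with_card_n)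
    have "\<forall>K\<in>Q. \<exists>a. a \<in> (K - {c}) \<inter> U" using Q(1) by blast
    then obtain a where a: "\<And>K. K \<in> Q \<Longrightarrow> a K \<in> (K - {c}) \<inter> U" by metis
    have Qm: "max_clique K" "c \<in> K" if "K \<in> Q" for K using that Q by auto
    have inj: "inj_on a Q" using a Qm max_clique_share by (intro inj_onI) (metis DiffD1 DiffD2 IntD1 singletonI)
    have na: "(a K, a L) \<notin> E" if "K \<in> Q" "L \<in> Q" for K L
    proof
      assume e: "(a K, a L) \<in> E"
      have "clique {c, a K, a L}"
        using e a[OF that(1)] a[OF that(2)] Qm[OF that(1)] Qm[OF that(2)]
          max_clique_edge[of K c "a K"] max_clique_edge[of L c "a L"] E_in_V[OF e] assms c
        by (auto simp: clique_def E_commute)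
      then obtain M where M: "max_clique M" "{c, a K, a L} \<subseteq> M" using clique_extend by blast
      have "M = K" "M = L"
        using max_clique_share[OF M(1), of K c "a K"] max_clique_share[OF M(1), of L c "a L"]
          M(2) a Qm that by auto
      then show False using E_neq[OF e] by simp
    qed
    have "(c, a K) \<in> E" if "K \<in> Q" for K
      using max_clique_edge[OF Qm(1)[OF that] Qm(2)[OF that]] a[OF that] by auto
    then show "\<exists>A\<subseteq>U. card A = 3 \<and> (\<forall>a\<in>A. (c, a) \<in> E) \<and> (\<forall>a\<in>A. \<forall>b\<in>A. (a, b) \<notin> E)"
      using a na card_image[OF inj] Q(2) by (intro exI[of _ "a ` Q"]) auto
  }
qed

end

section \<open>Minimum weights of products of set families\<close>

text \<open>Unlike \<open>Min\<close>, this carries the nonemptiness of the family along and asks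
  for no finiteness of it.\<close>

definition attains :: "('a \<Rightarrow> nat) \<Rightarrow> 'a set set \<Rightarrow> nat \<Rightarrow> bool" where
  "attains w A m \<longleftrightarrow> (\<exists>S\<in>A. sum w S = m) \<and> (\<forall>S\<in>A. m \<le> sum w S)"

lemma attainsI: "S \<in> A \<Longrightarrow> sum w S = m \<Longrightarrow> (\<And>S. S \<in> A \<Longrightarrow> m \<le> sum w S) \<Longrightarrow> attains w A m"
  unfolding attains_def by blast

lemma attains_Un:
  assumes "attains w A a" "attains w B b"
  shows "attains w (A \<union> B) (min a b)"
  using assms unfolding attains_def min_def by (auto intro: order_trans)

lemma attains_UN:
  assumes "finite J" "J \<noteq> {}" "\<And>j. j \<in> J \<Longrightarrow> attains w (A j) (m j)"
  shows "attains w (\<Union>j\<in>J. A j) (MIN j\<in>J. m j)"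
proof -
  have "(MIN j\<in>J. m j) \<in> m ` J" using assms by (intro Min_in) auto
  then obtain j where j: "j \<in> J" "(MIN j\<in>J. m j) = m j" by auto
  then obtain S where S: "S \<in> A j" "sum w S = m j" using assms(3) unfolding attains_def by blast
  show ?thesis
  proof (rule attainsI)
    show "S \<in> (\<Union>j\<in>J. A j)" using S j by auto
    show "sum w S = (MIN j\<in>J. m j)" using S j by simp
    fix T assume "T \<in> (\<Union>j\<in>J. A j)"
    then obtain i where i: "i \<in> J" "T \<in> A i" by auto
    then have "m i \<le> sum w T" using assms(3) unfolding attains_def by blast
    moreover have "(MIN j\<in>J. m j) \<le> m i" using assms(1) i by (intro Min_le) auto
    ultimately show "(MIN j\<in>J. m j) \<le> sum w T" by simp
  qed
qed

lemma attains_insert: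
  assumes "attains w A m" "\<And>S. S \<in> A \<Longrightarrow> finite S \<and> v \<notin> S"
  shows "attains w (insert v ` A) (w v + m)"
  using assms unfolding attains_def by auto

text \<open>The product of the families \<open>A i\<close>, encoded as sets: for disjoint
  \<open>D i\<close>, choosing \<open>S\<close> means choosing its traces on the \<open>D i\<close>
  independently.\<close>

definition pieces :: "'i set \<Rightarrow> ('i \<Rightarrow> 'a set) \<Rightarrow> ('i \<Rightarrow> 'a set set) \<Rightarrow> 'a set set" where
  "pieces I D A = {S. S \<subseteq> (\<Union>i\<in>I. D i) \<and> (\<forall>i\<in>I. S \<inter> D i \<in> A i)}"

text \<open>Minimisers are chosen separately in each part; disjointness makes the traces of their
  union the chosen sets and makes weights add up.\<close>

lemma attains_pieces:
  assumes fin: "finite I" "\<And>i. i \<in> I \<Longrightarrow> finite (D i)"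
    and disj: "\<And>i j. i \<in> I \<Longrightarrow> j \<in> I \<Longrightarrow> i \<noteq> j \<Longrightarrow> D i \<inter> D j = {}"
    and sub: "\<And>i S. i \<in> I \<Longrightarrow> S \<in> A i \<Longrightarrow> S \<subseteq> D i"
    and att: "\<And>i. i \<in> I \<Longrightarrow> attains w (A i) (m i)"
  shows "attains w (pieces I D A) (\<Sum>i\<in>I. m i)"
proof -
  have "\<forall>i\<in>I. \<exists>S\<in>A i. sum w S = m i" using att unfolding attains_def by blast
  then obtain T where T: "\<And>i. i \<in> I \<Longrightarrow> T i \<in> A i" "\<And>i. i \<in> I \<Longrightarrow> sum w (T i) = m i" by metis
  have TD: "T i \<subseteq> D i" if "i \<in> I" for i using sub T that by blast
  have sum_eq: "sum w S = (\<Sum>i\<in>I. sum w (S \<inter> D i))" if "S \<subseteq> (\<Union>i\<in>I. D i)" for S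
  proof -
    have "S = (\<Union>i\<in>I. S \<inter> D i)" using that by auto
    then have "sum w S = sum w (\<Union>i\<in>I. S \<inter> D i)" by simp
    also have "\<dots> = (\<Sum>i\<in>I. sum w (S \<inter> D i))"
      using fin disj by (intro sum.UNION_disjoint) blast+
    finally show ?thesis .
  qed
  have cap: "(\<Union>j\<in>I. T j) \<inter> D i = T i" if "i \<in> I" for i
  proof
    show "(\<Union>j\<in>I. T j) \<inter> D i \<subseteq> T i"
    proof
      fix x assume x: "x \<in> (\<Union>j\<in>I. T j) \<inter> D i"
      then obtain j where j: "j \<in> I" "x \<in> T j" by auto
      then have "j = i" using disj[OF j(1) that] TD[OF j(1)] x by blast
      then show "x \<in> T i" using j by simp
    qed
  qed (use that TD in auto)
  show ?thesis
  proof (rule attainsI)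
    have sub: "(\<Union>j\<in>I. T j) \<subseteq> (\<Union>i\<in>I. D i)" using TD by blast
    show "(\<Union>j\<in>I. T j) \<in> pieces I D A" using sub cap T unfolding pieces_def by simp
    show "sum w (\<Union>j\<in>I. T j) = (\<Sum>i\<in>I. m i)" using sum_eq[OF sub] cap T by simp
    fix S assume S: "S \<in> pieces I D A"
    have "m i \<le> sum w (S \<inter> D i)" if "i \<in> I" for i
      using S that att unfolding pieces_def attains_def by blast
    then have "(\<Sum>i\<in>I. m i) \<le> (\<Sum>i\<in>I. sum w (S \<inter> D i))" by (rule sum_mono)
    then show "(\<Sum>i\<in>I. m i) \<le> sum w S" using S sum_eq unfolding pieces_def by simp
  qed
qed

text \<open>\<open>a = b\<close> is allowed, just as \<open>b1\<close> and \<open>b2\<close> may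
  coincide in the minimum defining \<open>f2\<close> at a cutpoint.\<close>

lemma card_le_2_subset_pair:
  assumes "finite Q" "card Q \<le> 2" "Q \<subseteq> C" "C \<noteq> {}"
  shows "\<exists>a\<in>C. \<exists>b\<in>C. Q \<subseteq> {a, b}"
proof -
  consider "card Q = 0" | "card Q = 1" | "card Q = 2" using assms(2) by linarith
  then show ?thesis
  proof cases
    case 1
    then show ?thesis using assms by auto
  next
    case 2
    then obtain a where "Q = {a}" by (auto simp: card_1_singleton_iff)
    then show ?thesis using assms by auto
  next
    case 3
    then obtain a b where "Q = {a, b}" by (auto simp: card_2_iff)
    then show ?thesis using assms by auto
  qed
qed

lemma sum_if_split:
  fixes f g :: "'i \<Rightarrow> nat"
  assumes "finite C" "Q \<subseteq> C"
  shows "(\<Sum>K\<in>C. if K \<in> Q then f K else g K) = (\<Sum>K\<in>Q. f K) + (\<Sum>K\<in>C - Q. g K)"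
proof -
  have "C \<inter> Q = Q" "C \<inter> - Q = C - Q" using assms(2) by auto
  then show ?thesis using sum.If_cases[OF assms(1), of "\<lambda>K. K \<in> Q" f g] by simp
qed

section \<open>Claw-deletion sets in subtrees\<close>

context rooted_block_graph
begin

section \<open>Subtrees of the parent relation\<close>

definition below :: "'a \<Rightarrow> 'a set" where
  "below v = {u. (v, u) \<in> {(par u, u) | u. u \<in> V \<and> u \<noteq> r}\<^sup>*}"

definition child_blocks :: "'a \<Rightarrow> 'a set set" where
  "child_blocks v = {K. max_clique K \<and> apex K = v}"

definition members :: "'a set \<Rightarrow> 'a set" where
  "members K = K - {apex K}"

text \<open>For a block \<open>b\<close> this is the vertex set of \<open>G_b^-\<close>; for a
  cutpoint \<open>v\<close>, \<open>below v\<close> is that of \<open>G_v\<close>. At a vertex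
  without child blocks \<open>below\<close> is a singleton.\<close>

definition block_below :: "'a set \<Rightarrow> 'a set" where
  "block_below K = (\<Union>u\<in>members K. below u)"

lemma below_self [simp]: "v \<in> below v"
  unfolding below_def by simp

lemma below_step: "u \<in> V \<Longrightarrow> u \<noteq> r \<Longrightarrow> par u \<in> below v \<Longrightarrow> u \<in> below v"
  unfolding below_def by (auto intro: rtrancl_into_rtrancl)

lemma below_trans: "u \<in> below v \<Longrightarrow> x \<in> below u \<Longrightarrow> x \<in> below v"
  unfolding below_def by auto

lemma below_par:
  assumes "u \<in> below v" "u \<noteq> v"
  shows "u \<in> V" "u \<noteq> r" "par u \<in> below v"
  using assms unfolding below_def by (auto elim: rtranclE)

lemma below_induct [consumes 1, case_names self step]:
  assumes "u \<in> below v" "P v"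
    "\<And>u. u \<in> below v \<Longrightarrow> u \<in> V \<Longrightarrow> u \<noteq> r \<Longrightarrow> par u \<in> below v \<Longrightarrow> P (par u) \<Longrightarrow> P u"
  shows "P u"
proof -
  have "(v, u) \<in> {(par u, u) | u. u \<in> V \<and> u \<noteq> r}\<^sup>*" using assms(1) unfolding below_def by simp
  then show ?thesis
  proof induction
    case (step y z)
    then have z: "y = par z" "z \<in> V" "z \<noteq> r" by auto
    have "par z \<in> below v" using step(1) z unfolding below_def by simp
    then show ?case using assms(3)[of z] z step.IH below_step by simp
  qed (rule assms(2))
qed

lemma below_V: "v \<in> V \<Longrightarrow> below v \<subseteq> V"
  using below_par(1) by blast

lemma below_lev: "u \<in> below v \<Longrightarrow> u = v \<or> lev v < lev u"
proof (induction rule: below_induct)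
  case (step u)
  then show ?case using lev_par[of u] by auto
qed simp

lemma below_root: "below r = V"
proof
  show "V \<subseteq> below r"
  proof
    fix v assume "v \<in> V"
    then show "v \<in> below r"
    proof (induction "lev v" arbitrary: v rule: less_induct)
      case less
      show ?case
      proof (cases "v = r")
        case False
        then have "par v \<in> below r" using less lev_par par_in_V by simp
        then show ?thesis using below_step less.prems False by simp
      qed simp
    qed
  qed
qed (rule below_V[OF r_in])

lemma finite_below: "v \<in> V \<Longrightarrow> finite (below v)"
  using below_V finite_V finite_subset by blast

text \<open>The ancestors of \<open>z\<close> form one chain with strictly decreasing levels, so a
  given level contains at most one of them.\<close>

lemma below_disjoint:
  assumes "z \<in> below x" "z \<in> below y" "lev x = lev y"
  shows "x = y"
  using assms(1,2)
proof (induction rule: below_induct)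
  case self
  then show ?case using below_lev[of x y] assms(3) by auto
next
  case (step u)
  have "u \<noteq> y"
  proof
    assume "u = y"
    then have "lev (par u) < lev x" using lev_par[OF step(2,3)] assms(3) by simp
    then show False using below_lev[OF step(4)] by auto
  qed
  then show ?case using below_par(3)[OF step.prems] step.IH by simp
qed

lemma
  assumes "max_clique K" "u \<in> members K"
  shows members_V: "u \<in> V" and members_not_root: "u \<noteq> r" and members_par: "par u = apex K"
    and members_lev: "lev u = Suc (lev (apex K))" and members_home: "home u = K"
  using assms max_clique_sub root_apex par_apex lev_apex home_eqI unfolding members_def by auto

lemma apex_V: "max_clique K \<Longrightarrow> apex K \<in> V"
  using apex_in max_clique_sub by blast

lemma child_blocksD: "K \<in> child_blocks v \<Longrightarrow> max_clique K" "K \<in> child_blocks v \<Longrightarrow> apex K = v"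
  unfolding child_blocks_def by auto

lemma finite_child_blocks: "finite (child_blocks v)"
  using finite_max_cliques unfolding child_blocks_def by (rule rev_finite_subset) auto

lemma finite_members: "max_clique K \<Longrightarrow> finite (members K)"
  using finite_max_clique unfolding members_def by simp

lemma home_child_block: "u \<in> V \<Longrightarrow> u \<noteq> r \<Longrightarrow> home u \<in> child_blocks (par u)"
  unfolding child_blocks_def using home_max_clique apex_home by simp

lemma in_members_home: "u \<in> V \<Longrightarrow> u \<noteq> r \<Longrightarrow> u \<in> members (home u)"
  unfolding members_def using in_home[of u] home_not_child[of u] by simp

lemma members_sub_block_below: "members K \<subseteq> block_below K"
  unfolding block_below_def by auto

lemma finite_block_below: "max_clique K \<Longrightarrow> finite (block_below K)"
  unfolding block_below_def using finite_members finite_below members_V by blast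

lemma block_below_sub_below:
  assumes "K \<in> child_blocks v"
  shows "block_below K \<subseteq> below v"
proof
  fix z assume "z \<in> block_below K"
  then obtain u where u: "u \<in> members K" "z \<in> below u" unfolding block_below_def by auto
  have "u \<in> below v"
    using members_V[OF child_blocksD(1)[OF assms] u(1)] members_not_root[OF child_blocksD(1)[OF assms] u(1)]
      members_par[OF child_blocksD(1)[OF assms] u(1)] child_blocksD(2)[OF assms]
    by (simp add: below_step)
  then show "z \<in> below v" using below_trans u(2) by blast
qed

lemma apex_notin_block_below:
  assumes "max_clique K"
  shows "apex K \<notin> block_below K"
proof
  assume "apex K \<in> block_below K"
  then obtain u where u: "u \<in> members K" "apex K \<in> below u" unfolding block_below_def by auto
  then show False using below_lev[OF u(2)] members_lev[OF assms u(1)] by auto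
qed

lemma below_unfold: "below v = insert v (\<Union>K\<in>child_blocks v. block_below K)"
proof
  show "below v \<subseteq> insert v (\<Union>K\<in>child_blocks v. block_below K)"
  proof
    fix z assume "z \<in> below v"
    then show "z \<in> insert v (\<Union>K\<in>child_blocks v. block_below K)"
    proof (induction rule: below_induct)
      case (step u)
      from step(5) consider "par u = v" | K x where "K \<in> child_blocks v" "x \<in> members K" "par u \<in> below x"
        unfolding block_below_def by auto
      then show ?case
      proof cases
        case 1
        then show ?thesis
          using home_child_block[OF step(2,3)] in_members_home[OF step(2,3)] members_sub_block_below by auto
      next
        case 2
        then have "u \<in> below x" using below_step step(2,3) by blast
        then show ?thesis using 2 unfolding block_below_def by auto
      qed
    qed simp
  qed
qed (use block_below_sub_below in auto)

lemma block_below_disjoint: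
  assumes "K \<in> child_blocks v" "L \<in> child_blocks v" "K \<noteq> L"
  shows "block_below K \<inter> block_below L = {}"
proof (rule ccontr)
  assume "block_below K \<inter> block_below L \<noteq> {}"
  then obtain z x y where *: "x \<in> members K" "z \<in> below x" "y \<in> members L" "z \<in> below y"
    unfolding block_below_def by auto
  note KL = child_blocksD[OF assms(1)] child_blocksD[OF assms(2)]
  have "lev x = lev y" using members_lev[OF KL(1) *(1)] members_lev[OF KL(3) *(3)] KL by simp
  then have "x = y" using below_disjoint[OF *(2,4)] by simp
  then show False using members_home[OF KL(1) *(1)] members_home[OF KL(3) *(3)] assms(3) by simp
qed

lemma members_below_disjoint:
  assumes "max_clique K" "x \<in> members K" "y \<in> members K" "x \<noteq> y"
  shows "below x \<inter> below y = {}"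
  using below_disjoint[of _ x y] members_lev[OF assms(1)] assms by auto

text \<open>The apex of the block above \<open>z\<close> is \<open>par z\<close>, which is still
  below \<open>u\<close>, and the other vertices of that block have it as their parent.\<close>

lemma home_sub_below:
  assumes z: "z \<in> below u" "z \<noteq> u"
  shows "home z \<subseteq> below u"
proof
  fix x assume x: "x \<in> home z"
  note zV = below_par[OF z]
  show "x \<in> below u"
  proof (cases "x = par z")
    case False
    then have m: "x \<in> members (home z)" using x apex_home[OF zV(1,2)] unfolding members_def by simp
    note h = home_max_clique[OF zV(1,2)]
    show ?thesis using members_par[OF h m] apex_home[OF zV(1,2)] zV(3) members_V[OF h m] members_not_root[OF h m]
      by (simp add: below_step)
  qed (use zV in simp)
qed

lemma child_members_sub_below:
  assumes "z \<in> below u" "K \<in> child_blocks z"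
  shows "members K \<subseteq> below u"
  using members_sub_block_below block_below_sub_below[OF assms(2)] below_trans[OF assms(1)] by blast

section \<open>The claw condition at a vertex and its locality\<close>

definition alive :: "'a \<Rightarrow> 'a set \<Rightarrow> nat" where
  "alive v S = card {K \<in> child_blocks v. \<not> members K \<subseteq> S}"

text \<open>The count of blocks at \<open>v\<close> with another survivor, split as the tree sees it
  into child blocks and the block above; \<open>claw_free_at_iff\<close> undoes the split.\<close>

definition claw_free_at :: "'a \<Rightarrow> 'a set \<Rightarrow> bool" where
  "claw_free_at v S \<longleftrightarrow> v \<in> S \<or> alive v S + (if v = r \<or> home v - {v} \<subseteq> S then 0 else 1) \<le> 2"

lemma alive_cong:
  assumes "S \<inter> W = T \<inter> W" "\<And>K. K \<in> child_blocks v \<Longrightarrow> members K \<subseteq> W"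
  shows "alive v S = alive v T"
proof -
  have "{K \<in> child_blocks v. \<not> members K \<subseteq> S} = {K \<in> child_blocks v. \<not> members K \<subseteq> T}"
    using assms by blast
  then show ?thesis unfolding alive_def by simp
qed

text \<open>Only the vertices of the blocks at \<open>v\<close> matter. This locality is what
  separates the conditions in different subtrees.\<close>

lemma claw_free_at_cong:
  assumes "S \<inter> W = T \<inter> W" "v \<in> W" "v \<noteq> r" "home v \<subseteq> W" "\<And>K. K \<in> child_blocks v \<Longrightarrow> members K \<subseteq> W"
  shows "claw_free_at v S \<longleftrightarrow> claw_free_at v T"
proof -
  have "v \<in> S \<longleftrightarrow> v \<in> T" "home v - {v} \<subseteq> S \<longleftrightarrow> home v - {v} \<subseteq> T" using assms by blast+
  then show ?thesis using alive_cong[OF assms(1,5)] unfolding claw_free_at_def by simp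
qed

lemma alive_below: "alive u (S \<inter> below u) = alive u S"
  by (rule alive_cong[of _ "below u"]) (use child_members_sub_below[OF below_self] in auto)

lemma claw_free_at_below:
  assumes "z \<in> below u" "z \<noteq> u"
  shows "claw_free_at z (S \<inter> below u) \<longleftrightarrow> claw_free_at z S"
  by (rule claw_free_at_cong[of _ "below u"])
    (use assms below_par home_sub_below child_members_sub_below in auto)

text \<open>For a member of \<open>K\<close> the block above is \<open>K\<close> itself, so the apex
  is visible besides the subtree, but no other outside vertex is.\<close>

lemma claw_free_at_block_below:
  assumes K: "max_clique K" and z: "z \<in> block_below K"
    and eq: "S \<inter> insert (apex K) (block_below K) = T \<inter> insert (apex K) (block_below K)"
  shows "claw_free_at z S \<longleftrightarrow> claw_free_at z T"
proof -
  obtain u where u: "u \<in> members K" "z \<in> below u" using z unfolding block_below_def by auto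
  have ub: "below u \<subseteq> block_below K" using u unfolding block_below_def by auto
  show ?thesis
  proof (rule claw_free_at_cong[OF eq])
    show "z \<noteq> r" using u below_par[OF u(2)] members_not_root[OF K u(1)] by blast
    show "home z \<subseteq> insert (apex K) (block_below K)"
    proof (cases "z = u")
      case True
      then show ?thesis using members_home[OF K u(1)] members_sub_block_below[of K] unfolding members_def by auto
    qed (use home_sub_below[OF u(2)] ub in auto)
    show "members L \<subseteq> insert (apex K) (block_below K)" if "L \<in> child_blocks z" for L
      using child_members_sub_below[OF u(2) that] ub by auto
  qed (use z in simp)
qed

text \<open>
  The sets over which the values at the nodes are minima: \<open>f1\<close>, \<open>f2\<close>, \<open>f3\<close> belong to \<open>del_at v\<close>,
  \<open>keep_at 2 v\<close>, \<open>keep_at 1 v\<close> at a cutpoint and to \<open>del_members K\<close>, \<open>del_apex K\<close>, \<open>keep_apex K\<close> at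
  a block. In \<open>keep_at 1 v\<close> one of the two blocks allowed at \<open>v\<close> is reserved for the block above.
\<close>

definition del_at :: "'a \<Rightarrow> 'a set set" where
  "del_at v = {S. S \<subseteq> below v \<and> v \<in> S \<and> (\<forall>u\<in>below v - {v}. claw_free_at u S)}"

definition keep_at :: "nat \<Rightarrow> 'a \<Rightarrow> 'a set set" where
  "keep_at k v = {S. S \<subseteq> below v \<and> v \<notin> S \<and> alive v S \<le> k \<and> (\<forall>u\<in>below v - {v}. claw_free_at u S)}"

definition del_members :: "'a set \<Rightarrow> 'a set set" where
  "del_members K = {S. S \<subseteq> block_below K \<and> members K \<subseteq> S \<and> (\<forall>u\<in>block_below K. claw_free_at u S)}"

definition del_apex :: "'a set \<Rightarrow> 'a set set" where
  "del_apex K = {S. S \<subseteq> block_below K \<and> (\<forall>u\<in>block_below K. claw_free_at u (insert (apex K) S))}"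

definition keep_apex :: "'a set \<Rightarrow> 'a set set" where
  "keep_apex K = {S. S \<subseteq> block_below K \<and> (\<forall>u\<in>block_below K. claw_free_at u S)}"

section \<open>Decomposition of the families at a vertex into its child blocks\<close>

lemma below_minus:
  "below v - {v} = (\<Union>K\<in>child_blocks v. block_below K)"
proof -
  have "v \<notin> block_below K" if "K \<in> child_blocks v" for K
    using apex_notin_block_below[OF child_blocksD(1)[OF that]] child_blocksD(2)[OF that] by simp
  then show ?thesis using below_unfold[of v] by auto
qed

lemma claw_free_at_insert_apex:
  assumes K: "K \<in> child_blocks v" and u: "u \<in> block_below K" and v: "v \<in> S"
  shows "claw_free_at u (insert (apex K) (S \<inter> block_below K)) \<longleftrightarrow> claw_free_at u S"
proof -
  have "insert v (S \<inter> block_below K) \<inter> insert v (block_below K) = S \<inter> insert v (block_below K)"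
    using v by auto
  then show ?thesis
    using claw_free_at_block_below[OF child_blocksD(1)[OF K] u] child_blocksD(2)[OF K] by metis
qed

lemma claw_free_at_restrict:
  assumes K: "K \<in> child_blocks v" and u: "u \<in> block_below K" and v: "v \<notin> S"
  shows "claw_free_at u (S \<inter> block_below K) \<longleftrightarrow> claw_free_at u S"
proof -
  have "S \<inter> block_below K \<inter> insert v (block_below K) = S \<inter> insert v (block_below K)"
    using v by auto
  then show ?thesis
    using claw_free_at_block_below[OF child_blocksD(1)[OF K] u] child_blocksD(2)[OF K] by metis
qed

text \<open>A deleted \<open>v\<close> needs no condition of its own, and each child block sees only
  that its apex is gone; so the choices in different child blocks are independent.\<close>

lemma del_at_eq:
  "del_at v = insert v ` pieces (child_blocks v) block_below del_apex"
proof (intro set_eqI iffI)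
  have key: "(\<forall>u\<in>below v - {v}. claw_free_at u S) \<longleftrightarrow> (\<forall>K\<in>child_blocks v. S \<inter> block_below K \<in> del_apex K)"
    if "v \<in> S" for S
    unfolding below_minus del_apex_def using claw_free_at_insert_apex[OF _ _ that] by simp
  {
    fix S assume S: "S \<in> del_at v"
    then have "S - {v} \<in> pieces (child_blocks v) block_below del_apex"
    proof -
      have "(S - {v}) \<inter> block_below K = S \<inter> block_below K" if "K \<in> child_blocks v" for K
        using apex_notin_block_below[OF child_blocksD(1)[OF that]] child_blocksD(2)[OF that] by auto
      moreover have "S - {v} \<subseteq> (\<Union>K\<in>child_blocks v. block_below K)"
        using S below_minus[of v] unfolding del_at_def by blast
      ultimately show ?thesis using S key[of S] unfolding pieces_def del_at_def by simp
    qed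
    moreover have "S = insert v (S - {v})" using S unfolding del_at_def by auto
    ultimately show "S \<in> insert v ` pieces (child_blocks v) block_below del_apex" by blast
  next
    fix S assume "S \<in> insert v ` pieces (child_blocks v) block_below del_apex"
    then obtain T where T: "S = insert v T" "T \<in> pieces (child_blocks v) block_below del_apex" by auto
    have "insert v T \<inter> block_below K = T \<inter> block_below K" if "K \<in> child_blocks v" for K
      using apex_notin_block_below[OF child_blocksD(1)[OF that]] child_blocksD(2)[OF that] by auto
    then show "S \<in> del_at v" using T key[of S] below_unfold[of v] unfolding pieces_def del_at_def by auto
  }
qed

text \<open>With \<open>v\<close> kept, the child blocks interact only through the number of those
  with a surviving member. Within \<open>keep_apex K\<close>, \<open>del_members K\<close> singles
  out the choices for which \<open>K\<close> does not count.\<close>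

lemma keep_at_eq:
  "keep_at k v = {S \<in> pieces (child_blocks v) block_below keep_apex.
    card {K \<in> child_blocks v. S \<inter> block_below K \<notin> del_members K} \<le> k}"
proof (intro set_eqI)
  fix S
  show "S \<in> keep_at k v \<longleftrightarrow> S \<in> {S \<in> pieces (child_blocks v) block_below keep_apex.
    card {K \<in> child_blocks v. S \<inter> block_below K \<notin> del_members K} \<le> k}"
  proof (cases "S \<subseteq> below v \<and> v \<notin> S")
    case True
    have 1: "(\<forall>u\<in>below v - {v}. claw_free_at u S) \<longleftrightarrow> (\<forall>K\<in>child_blocks v. S \<inter> block_below K \<in> keep_apex K)"
      unfolding below_minus keep_apex_def using claw_free_at_restrict[of _ v _ S] True by simp
    have 2: "S \<subseteq> (\<Union>K\<in>child_blocks v. block_below K)" using True below_minus[of v] by blast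
    have 3: "S \<inter> block_below K \<in> del_members K \<longleftrightarrow> members K \<subseteq> S"
      if "S \<inter> block_below K \<in> keep_apex K" for K
      using that members_sub_block_below[of K] unfolding keep_apex_def del_members_def by auto
    show ?thesis
    proof (cases "\<forall>K\<in>child_blocks v. S \<inter> block_below K \<in> keep_apex K")
      case ok: True
      then have "{K \<in> child_blocks v. S \<inter> block_below K \<notin> del_members K} = {K \<in> child_blocks v. \<not> members K \<subseteq> S}"
        using 3 by auto
      then show ?thesis using True 1 2 ok unfolding pieces_def keep_at_def alive_def by simp
    next
      case False
      then show ?thesis using 1 unfolding pieces_def keep_at_def by auto
    qed
  next
    case False
    then have "\<not> S \<subseteq> (\<Union>K\<in>child_blocks v. block_below K)" using below_minus[of v] by blast
    then show ?thesis using False unfolding pieces_def keep_at_def by auto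
  qed
qed

lemma del_members_sub: "del_members K \<subseteq> keep_apex K"
  unfolding del_members_def keep_apex_def by auto

text \<open>With so few child blocks the bound is vacuous, which is why the recursion treats at most
  two children in \<open>f2\<close> and a single child in \<open>f3\<close> separately.\<close>

lemma keep_at_all:
  assumes "card (child_blocks v) \<le> k"
  shows "keep_at k v = pieces (child_blocks v) block_below keep_apex"
proof -
  have "card {K \<in> child_blocks v. S \<inter> block_below K \<notin> del_members K} \<le> k" for S
    using assms by (rule order_trans[OF card_mono[OF finite_child_blocks], rotated]) blast
  then show ?thesis unfolding keep_at_eq by auto
qed

text \<open>The blocks allowed to survive are guessed. As \<open>del_members K\<close> is contained
  in \<open>keep_apex K\<close>, a guessed block need not really survive; the union overlaps, which
  is harmless for a minimum.\<close>

lemma keep_at_two: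
  assumes "child_blocks v \<noteq> {}"
  shows "keep_at 2 v = (\<Union>a\<in>child_blocks v. \<Union>b\<in>child_blocks v.
    pieces (child_blocks v) block_below (\<lambda>K. if K \<in> {a, b} then keep_apex K else del_members K))"
proof (intro set_eqI iffI)
  fix S assume S: "S \<in> keep_at 2 v"
  let ?Q = "{K \<in> child_blocks v. S \<inter> block_below K \<notin> del_members K}"
  have "\<exists>a\<in>child_blocks v. \<exists>b\<in>child_blocks v. ?Q \<subseteq> {a, b}"
    using S assms finite_child_blocks unfolding keep_at_eq by (intro card_le_2_subset_pair) auto
  then obtain a b where ab: "a \<in> child_blocks v" "b \<in> child_blocks v" "?Q \<subseteq> {a, b}" by auto
  then have "S \<in> pieces (child_blocks v) block_below (\<lambda>K. if K \<in> {a, b} then keep_apex K else del_members K)"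
    using S unfolding keep_at_eq pieces_def by auto
  then show "S \<in> (\<Union>a\<in>child_blocks v. \<Union>b\<in>child_blocks v.
    pieces (child_blocks v) block_below (\<lambda>K. if K \<in> {a, b} then keep_apex K else del_members K))"
    using ab by blast
next
  fix S assume "S \<in> (\<Union>a\<in>child_blocks v. \<Union>b\<in>child_blocks v.
    pieces (child_blocks v) block_below (\<lambda>K. if K \<in> {a, b} then keep_apex K else del_members K))"
  then obtain a b where
    S: "S \<in> pieces (child_blocks v) block_below (\<lambda>K. if K \<in> {a, b} then keep_apex K else del_members K)" by blast
  have "{K \<in> child_blocks v. S \<inter> block_below K \<notin> del_members K} \<subseteq> {a, b}"
    using S unfolding pieces_def by (auto split: if_splits)
  then have "card {K \<in> child_blocks v. S \<inter> block_below K \<notin> del_members K} \<le> card {a, b}"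
    by (intro card_mono) auto
  also have "\<dots> \<le> 2" by (simp add: card_insert_if)
  finally have "card {K \<in> child_blocks v. S \<inter> block_below K \<notin> del_members K} \<le> 2" .
  moreover have "S \<inter> block_below K \<in> keep_apex K" if "K \<in> child_blocks v" for K
  proof -
    have "S \<inter> block_below K \<in> (if K \<in> {a, b} then keep_apex K else del_members K)"
      using S that unfolding pieces_def by blast
    then show ?thesis using subsetD[OF del_members_sub[of K]] by (metis (full_types))
  qed
  ultimately show "S \<in> keep_at 2 v"
    using S unfolding keep_at_eq pieces_def by blast
qed

lemma keep_at_one:
  assumes "child_blocks v \<noteq> {}"
  shows "keep_at 1 v = (\<Union>a\<in>child_blocks v.
    pieces (child_blocks v) block_below (\<lambda>K. if K = a then keep_apex K else del_members K))"
proof (intro set_eqI iffI)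
  fix S assume S: "S \<in> keep_at 1 v"
  let ?Q = "{K \<in> child_blocks v. S \<inter> block_below K \<notin> del_members K}"
  have fin: "finite ?Q" using finite_child_blocks by simp
  have "card ?Q \<le> 1" using S unfolding keep_at_eq by simp
  then have "\<exists>a\<in>child_blocks v. ?Q \<subseteq> {a}"
  proof (cases "?Q = {}")
    case True
    then show ?thesis using assms by (metis empty_subsetI ex_in_conv)
  next
    case False
    then have "0 < card ?Q" unfolding card_gt_0_iff using fin by (rule conjI)
    then have "card ?Q = 1" using \<open>card ?Q \<le> 1\<close> by linarith
    then obtain a where a: "?Q = {a}" by (rule card_1_singletonE)
    then have "a \<in> child_blocks v" by blast
    then show ?thesis using a by blast
  qed
  then obtain a where ab: "a \<in> child_blocks v" "?Q \<subseteq> {a}" by auto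
  then have "S \<in> pieces (child_blocks v) block_below (\<lambda>K. if K = a then keep_apex K else del_members K)"
    using S unfolding keep_at_eq pieces_def by auto
  then show "S \<in> (\<Union>a\<in>child_blocks v.
    pieces (child_blocks v) block_below (\<lambda>K. if K = a then keep_apex K else del_members K))"
    using ab by blast
next
  fix S assume "S \<in> (\<Union>a\<in>child_blocks v.
    pieces (child_blocks v) block_below (\<lambda>K. if K = a then keep_apex K else del_members K))"
  then obtain a where
    S: "S \<in> pieces (child_blocks v) block_below (\<lambda>K. if K = a then keep_apex K else del_members K)" by blast
  have "{K \<in> child_blocks v. S \<inter> block_below K \<notin> del_members K} \<subseteq> {a}"
    using S unfolding pieces_def by (auto split: if_splits)
  then have "card {K \<in> child_blocks v. S \<inter> block_below K \<notin> del_members K} \<le> card {a}"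
    by (intro card_mono) auto
  then have "card {K \<in> child_blocks v. S \<inter> block_below K \<notin> del_members K} \<le> 1" by simp
  moreover have "S \<inter> block_below K \<in> keep_apex K" if "K \<in> child_blocks v" for K
  proof -
    have "S \<inter> block_below K \<in> (if K = a then keep_apex K else del_members K)"
      using S that unfolding pieces_def by blast
    then show ?thesis using subsetD[OF del_members_sub[of K]] by (metis (full_types))
  qed
  ultimately show "S \<in> keep_at 1 v"
    using S unfolding keep_at_eq pieces_def by blast
qed

lemma keep_apex_below: "S \<in> keep_apex K \<Longrightarrow> S \<subseteq> block_below K"
  and del_apex_below: "S \<in> del_apex K \<Longrightarrow> S \<subseteq> block_below K"
  and del_members_below: "S \<in> del_members K \<Longrightarrow> S \<subseteq> block_below K"
  and del_at_below: "S \<in> del_at v \<Longrightarrow> S \<subseteq> below v"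
  and keep_at_below: "S \<in> keep_at k v \<Longrightarrow> S \<subseteq> below v"
  unfolding keep_apex_def del_apex_def del_members_def del_at_def keep_at_def by simp_all

lemma attains_child_pieces:
  assumes "\<And>K. K \<in> child_blocks v \<Longrightarrow> attains w (A K) (m K)"
    and "\<And>K S. K \<in> child_blocks v \<Longrightarrow> S \<in> A K \<Longrightarrow> S \<subseteq> block_below K"
  shows "attains w (pieces (child_blocks v) block_below A) (\<Sum>K\<in>child_blocks v. m K)"
  using assms
  by (intro attains_pieces finite_child_blocks)
    (simp_all add: finite_block_below[OF child_blocksD(1)] block_below_disjoint)

lemma attains_del_at:
  assumes "\<And>K. K \<in> child_blocks v \<Longrightarrow> attains w (del_apex K) (h2 K)"
  shows "attains w (del_at v) (w v + (\<Sum>K\<in>child_blocks v. h2 K))"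
  unfolding del_at_eq
proof (rule attains_insert)
  show "attains w (pieces (child_blocks v) block_below del_apex) (\<Sum>K\<in>child_blocks v. h2 K)"
    using assms del_apex_below by (rule attains_child_pieces)
  fix S assume "S \<in> pieces (child_blocks v) block_below del_apex"
  then have "S \<subseteq> below v - {v}" unfolding pieces_def below_minus by simp
  moreover have "finite (below v - {v})"
    unfolding below_minus by (intro finite_UN_I finite_child_blocks finite_block_below child_blocksD(1))
  ultimately show "finite S \<and> v \<notin> S" using finite_subset by auto
qed

lemma attains_keep_at_two:
  assumes att: "\<And>K. K \<in> child_blocks v \<Longrightarrow> attains w (del_members K) (h1 K)"
    "\<And>K. K \<in> child_blocks v \<Longrightarrow> attains w (keep_apex K) (h3 K)"
  shows "attains w (keep_at 2 v) (if card (child_blocks v) \<le> 2 then \<Sum>K\<in>child_blocks v. h3 K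
    else MIN a\<in>child_blocks v. MIN b\<in>child_blocks v.
      (\<Sum>K\<in>{a, b}. h3 K) + (\<Sum>K\<in>child_blocks v - {a, b}. h1 K))"
proof (cases "card (child_blocks v) \<le> 2")
  case True
  have "attains w (keep_at 2 v) (\<Sum>K\<in>child_blocks v. h3 K)"
    unfolding keep_at_all[OF True] using att(2) keep_apex_below by (rule attains_child_pieces)
  then show ?thesis using True by simp
next
  case False
  then have ne: "child_blocks v \<noteq> {}" by auto
  have "attains w (keep_at 2 v) (MIN a\<in>child_blocks v. MIN b\<in>child_blocks v.
      (\<Sum>K\<in>{a, b}. h3 K) + (\<Sum>K\<in>child_blocks v - {a, b}. h1 K))"
    unfolding keep_at_two[OF ne]
  proof (intro attains_UN finite_child_blocks ne)
    fix a b assume ab: "a \<in> child_blocks v" "b \<in> child_blocks v"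
    have "attains w (pieces (child_blocks v) block_below (\<lambda>K. if K \<in> {a, b} then keep_apex K else del_members K))
      (\<Sum>K\<in>child_blocks v. if K \<in> {a, b} then h3 K else h1 K)"
    proof (rule attains_child_pieces)
      fix K assume K: "K \<in> child_blocks v"
      show "attains w (if K \<in> {a, b} then keep_apex K else del_members K) (if K \<in> {a, b} then h3 K else h1 K)"
        using att K by presburger
      show "S \<subseteq> block_below K" if "S \<in> (if K \<in> {a, b} then keep_apex K else del_members K)" for S
        using that keep_apex_below del_members_below by (metis (full_types))
    qed
    moreover have "(\<Sum>K\<in>child_blocks v. if K \<in> {a, b} then h3 K else h1 K) =
      (\<Sum>K\<in>{a, b}. h3 K) + (\<Sum>K\<in>child_blocks v - {a, b}. h1 K)"
      by (rule sum_if_split[OF finite_child_blocks]) (use ab in blast)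
    ultimately show "attains w (pieces (child_blocks v) block_below (\<lambda>K. if K \<in> {a, b} then keep_apex K else del_members K))
      ((\<Sum>K\<in>{a, b}. h3 K) + (\<Sum>K\<in>child_blocks v - {a, b}. h1 K))"
      by (rule subst[rotated])
  qed
  then show ?thesis using False by simp
qed

lemma attains_keep_at_one:
  assumes att: "\<And>K. K \<in> child_blocks v \<Longrightarrow> attains w (del_members K) (h1 K)"
    "\<And>K. K \<in> child_blocks v \<Longrightarrow> attains w (keep_apex K) (h3 K)"
    and ne: "child_blocks v \<noteq> {}"
  shows "attains w (keep_at 1 v) (if is_singleton (child_blocks v) then h3 (the_elem (child_blocks v))
    else MIN a\<in>child_blocks v. h3 a + (\<Sum>K\<in>child_blocks v - {a}. h1 K))"
proof (cases "is_singleton (child_blocks v)")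
  case True
  then obtain a where a: "child_blocks v = {a}" by (rule is_singletonE)
  then have "card (child_blocks v) \<le> 1" by simp
  have "attains w (keep_at 1 v) (\<Sum>K\<in>child_blocks v. h3 K)"
    unfolding keep_at_all[OF \<open>card (child_blocks v) \<le> 1\<close>] using att(2) keep_apex_below
    by (rule attains_child_pieces)
  then show ?thesis using True a by simp
next
  case False
  have "attains w (keep_at 1 v) (MIN a\<in>child_blocks v. h3 a + (\<Sum>K\<in>child_blocks v - {a}. h1 K))"
    unfolding keep_at_one[OF ne]
  proof (intro attains_UN finite_child_blocks ne)
    fix a assume a: "a \<in> child_blocks v"
    have "attains w (pieces (child_blocks v) block_below (\<lambda>K. if K = a then keep_apex K else del_members K))
      (\<Sum>K\<in>child_blocks v. if K = a then h3 K else h1 K)"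
    proof (rule attains_child_pieces)
      fix K assume K: "K \<in> child_blocks v"
      show "attains w (if K = a then keep_apex K else del_members K) (if K = a then h3 K else h1 K)"
        using att K by presburger
      show "S \<subseteq> block_below K" if "S \<in> (if K = a then keep_apex K else del_members K)" for S
        using that keep_apex_below del_members_below by (metis (full_types))
    qed
    moreover have "(\<Sum>K\<in>child_blocks v. if K = a then h3 K else h1 K) = h3 a + (\<Sum>K\<in>child_blocks v - {a}. h1 K)"
      using sum_if_split[OF finite_child_blocks, of "{a}" v h3 h1] a by simp
    ultimately show "attains w (pieces (child_blocks v) block_below (\<lambda>K. if K = a then keep_apex K else del_members K))
      (h3 a + (\<Sum>K\<in>child_blocks v - {a}. h1 K))" by simp
  qed
  then show ?thesis using False by simp
qed

text \<open>Without child blocks the only choice is whether \<open>v\<close> itself is deleted.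
  These values stand in for the recursion at vertices that are not nodes of the tree.\<close>

lemma
  assumes "child_blocks v = {}"
  shows attains_del_at_leaf: "attains w (del_at v) (w v)"
    and attains_keep_at_leaf: "attains w (keep_at k v) 0"
proof -
  have "del_at v = {{v}}" unfolding del_at_eq assms pieces_def by auto
  then show "attains w (del_at v) (w v)" unfolding attains_def by simp
  have "keep_at k v = {{}}" unfolding keep_at_eq assms pieces_def by auto
  then show "attains w (keep_at k v) 0" unfolding attains_def by simp
qed

section \<open>Decomposition of the families at a block into its members\<close>

lemma members_decompose:
  assumes K: "max_clique K" and T: "\<And>u. u \<in> members K \<Longrightarrow> T \<inter> below u = S \<inter> below u"
  shows "(\<forall>z\<in>block_below K. claw_free_at z T) \<longleftrightarrow>
    (\<forall>u\<in>members K. claw_free_at u T \<and> (\<forall>z\<in>below u - {u}. claw_free_at z (S \<inter> below u)))"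
proof -
  have "(\<forall>z\<in>below u. claw_free_at z T) \<longleftrightarrow>
      claw_free_at u T \<and> (\<forall>z\<in>below u - {u}. claw_free_at z (S \<inter> below u))"
    if u: "u \<in> members K" for u
  proof -
    \<comment> \<open>\<open>T\<close> will be \<open>S\<close> or \<open>insert (apex K) S\<close>.
      Strict descendants of a member cannot tell the two apart; only the members themselves
      can.\<close>
    have "claw_free_at z T \<longleftrightarrow> claw_free_at z (S \<inter> below u)" if "z \<in> below u - {u}" for z
      using claw_free_at_below[of z u T] T[OF u] that by simp
    moreover have "below u = insert u (below u - {u})" by auto
    ultimately show ?thesis by (metis (no_types, lifting) insert_iff)
  qed
  then show ?thesis unfolding block_below_def by simp
qed

lemma del_at_or_keep_at:
  "S \<inter> below u \<in> del_at u \<longleftrightarrow> u \<in> S \<and> (\<forall>z\<in>below u - {u}. claw_free_at z (S \<inter> below u))"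
  "S \<inter> below u \<in> keep_at k u \<longleftrightarrow>
    u \<notin> S \<and> alive u S \<le> k \<and> (\<forall>z\<in>below u - {u}. claw_free_at z (S \<inter> below u))"
  unfolding del_at_def keep_at_def using alive_below[of u S] by auto

text \<open>Deleted members satisfy their own condition trivially, so only the conditions strictly
  below each of them remain.\<close>

lemma del_members_eq:
  assumes K: "max_clique K"
  shows "del_members K = pieces (members K) below del_at"
proof (intro set_eqI)
  fix S
  have "members K \<subseteq> S \<Longrightarrow> u \<in> members K \<Longrightarrow> claw_free_at u S" for u unfolding claw_free_at_def by blast
  then show "S \<in> del_members K \<longleftrightarrow> S \<in> pieces (members K) below del_at"
    unfolding del_members_def pieces_def members_decompose[OF K refl] del_at_or_keep_at
    unfolding block_below_def by blast
qed

text \<open>The surviving apex uses up one of the two blocks allowed at each surviving member, which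
  leaves one child block: hence \<open>keep_at 1\<close>.\<close>

lemma keep_apex_eq:
  assumes K: "max_clique K"
  shows "keep_apex K = pieces (members K) below (\<lambda>u. del_at u \<union> keep_at 1 u)"
proof (intro set_eqI)
  fix S
  have "claw_free_at u S \<longleftrightarrow> u \<in> S \<or> alive u S \<le> 1" if u: "u \<in> members K" and S: "S \<subseteq> block_below K" for u
  proof -
    have "apex K \<noteq> u" "apex K \<notin> S" using apex_notin_block_below[OF K] S u unfolding members_def by auto
    then have "\<not> home u - {u} \<subseteq> S" using members_home[OF K u] apex_in[OF K] by auto
    then show ?thesis using members_not_root[OF K u] unfolding claw_free_at_def by auto
  qed
  then show "S \<in> keep_apex K \<longleftrightarrow> S \<in> pieces (members K) below (\<lambda>u. del_at u \<union> keep_at 1 u)"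
    unfolding keep_apex_def pieces_def members_decompose[OF K refl] Un_iff del_at_or_keep_at
    unfolding block_below_def by blast
qed

text \<open>With the apex deleted, \<open>K\<close> counts at a surviving member only if another
  member survives. So either every surviving member has at most one surviving child block, or some
  \<open>v\<close> has two and is the only survivor of \<open>K\<close>. Such a \<open>v\<close> has
  child blocks, which is why the minimum over \<open>v1\<close> in \<open>f2\<close> ranges over
  tree nodes only.\<close>

lemma del_apex_eq:
  assumes K: "max_clique K"
  shows "del_apex K = pieces (members K) below (\<lambda>u. del_at u \<union> keep_at 1 u) \<union>
    (\<Union>v\<in>{u \<in> members K. child_blocks u \<noteq> {}}.
      pieces (members K) below (\<lambda>u. if u = v then keep_at 2 u else del_at u))"
proof (intro set_eqI)
  fix S
  let ?C = "{u \<in> members K. child_blocks u \<noteq> {}}"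
  let ?T = "insert (apex K) S"
  let ?I = "\<forall>u\<in>members K. \<forall>z\<in>below u - {u}. claw_free_at z (S \<inter> below u)"
  have apex_below: "apex K \<notin> below u" if "u \<in> members K" for u
    using apex_notin_block_below[OF K] that unfolding block_below_def by blast
  have T_below: "?T \<inter> below u = S \<inter> below u" if "u \<in> members K" for u
    using apex_below[OF that] by auto
  have T_in: "u \<in> ?T \<longleftrightarrow> u \<in> S" "alive u ?T = alive u S" if "u \<in> members K" for u
    using that alive_below[of u S] alive_below[of u ?T] T_below[OF that] unfolding members_def by auto
  have free: "claw_free_at u ?T \<longleftrightarrow> u \<in> S \<or> alive u S \<le> 1 \<or> alive u S \<le> 2 \<and> members K - {u} \<subseteq> S"
    if u: "u \<in> members K" for u
  proof -
    have "home u - {u} = insert (apex K) (members K - {u})"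
      using members_home[OF K u] u apex_in[OF K] unfolding members_def by auto
    then have "home u - {u} \<subseteq> ?T \<longleftrightarrow> members K - {u} \<subseteq> S" unfolding members_def by auto
    then show ?thesis
      using members_not_root[OF K u] T_in[OF u] unfolding claw_free_at_def by auto
  qed
  have leaf: "u \<in> ?C" if "u \<in> members K" "\<not> alive u S \<le> 1" for u
    using that unfolding alive_def by auto
  have eq_cases: "(\<forall>u\<in>members K. claw_free_at u ?T) \<longleftrightarrow>
    (\<forall>u\<in>members K. u \<in> S \<or> u \<notin> S \<and> alive u S \<le> 1) \<or>
    (\<exists>v\<in>?C. v \<notin> S \<and> alive v S \<le> 2 \<and> members K - {v} \<subseteq> S)"
    (is "?L \<longleftrightarrow> ?A \<or> ?B")
  proof
    assume L: ?L
    show "?A \<or> ?B"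
    proof (cases ?A)
      case False
      then obtain v where v: "v \<in> members K" "v \<notin> S" "\<not> alive v S \<le> 1" by blast
      then have "alive v S \<le> 2 \<and> members K - {v} \<subseteq> S" using L free[OF v(1)] by blast
      then show ?thesis using leaf[OF v(1,3)] v(2) by blast
    qed blast
  next
    assume "?A \<or> ?B"
    then show ?L
    proof
      assume ?B
      then obtain v where v: "v \<in> ?C" "alive v S \<le> 2" "members K - {v} \<subseteq> S" by blast
      show ?L
      proof
        fix u assume u: "u \<in> members K"
        show "claw_free_at u ?T" using free[OF u] v u by (cases "u = v") auto
      qed
    qed (use free in blast)
  qed
  have eq_B: "(\<exists>v\<in>?C. v \<notin> S \<and> alive v S \<le> 2 \<and> members K - {v} \<subseteq> S) \<and> ?I \<longleftrightarrow>
    (\<exists>v\<in>?C. \<forall>u\<in>members K. S \<inter> below u \<in> (if u = v then keep_at 2 u else del_at u))"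
  proof -
    have "(v \<notin> S \<and> alive v S \<le> 2 \<and> members K - {v} \<subseteq> S) \<and> ?I \<longleftrightarrow>
      (\<forall>u\<in>members K. S \<inter> below u \<in> (if u = v then keep_at 2 u else del_at u))" if "v \<in> ?C" for v
    proof -
      have "S \<inter> below u \<in> (if u = v then keep_at 2 u else del_at u) \<longleftrightarrow>
        (if u = v then v \<notin> S \<and> alive v S \<le> 2 else u \<in> S) \<and> (\<forall>z\<in>below u - {u}. claw_free_at z (S \<inter> below u))" for u
        using del_at_or_keep_at[of S u] by (cases "u = v") simp_all
      moreover have "(\<forall>u\<in>members K. if u = v then v \<notin> S \<and> alive v S \<le> 2 else u \<in> S) \<longleftrightarrow>
        v \<notin> S \<and> alive v S \<le> 2 \<and> members K - {v} \<subseteq> S" using that by auto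
      ultimately show ?thesis by meson
    qed
    then show ?thesis by blast
  qed
  have eq_A: "(\<forall>u\<in>members K. u \<in> S \<or> u \<notin> S \<and> alive u S \<le> 1) \<and> ?I \<longleftrightarrow>
    (\<forall>u\<in>members K. S \<inter> below u \<in> del_at u \<union> keep_at 1 u)"
    unfolding Un_iff del_at_or_keep_at by blast
  have eq_L: "(\<forall>z\<in>block_below K. claw_free_at z ?T) \<longleftrightarrow> (\<forall>u\<in>members K. claw_free_at u ?T) \<and> ?I"
    using members_decompose[OF K T_below] by blast
  have "S \<in> del_apex K \<longleftrightarrow> S \<subseteq> block_below K \<and> (\<forall>z\<in>block_below K. claw_free_at z ?T)"
    unfolding del_apex_def by simp
  moreover have "S \<in> pieces (members K) below (\<lambda>u. del_at u \<union> keep_at 1 u) \<longleftrightarrow>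
    S \<subseteq> block_below K \<and> (\<forall>u\<in>members K. S \<inter> below u \<in> del_at u \<union> keep_at 1 u)"
    unfolding pieces_def block_below_def by simp
  moreover have "S \<in> (\<Union>v\<in>?C. pieces (members K) below (\<lambda>u. if u = v then keep_at 2 u else del_at u)) \<longleftrightarrow>
    S \<subseteq> block_below K \<and> (\<exists>v\<in>?C. \<forall>u\<in>members K. S \<inter> below u \<in> (if u = v then keep_at 2 u else del_at u))"
    unfolding pieces_def block_below_def UN_iff mem_Collect_eq by blast
  ultimately show "S \<in> del_apex K \<longleftrightarrow> S \<in> pieces (members K) below (\<lambda>u. del_at u \<union> keep_at 1 u) \<union>
    (\<Union>v\<in>?C. pieces (members K) below (\<lambda>u. if u = v then keep_at 2 u else del_at u))"
    unfolding Un_iff[of S] eq_A[symmetric] eq_B[symmetric] eq_L eq_cases by argo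
qed

lemma attains_member_pieces:
  assumes K: "max_clique K"
    and "\<And>u. u \<in> members K \<Longrightarrow> attains w (A u) (m u)"
    and "\<And>u S. u \<in> members K \<Longrightarrow> S \<in> A u \<Longrightarrow> S \<subseteq> below u"
  shows "attains w (pieces (members K) below A) (\<Sum>u\<in>members K. m u)"
  using assms
  by (intro attains_pieces finite_members)
    (simp_all add: finite_below[OF members_V[OF K]] members_below_disjoint[OF K])

context
  fixes K :: "'a set" and w g1 g2 g3 :: "'a \<Rightarrow> nat"
  assumes K: "max_clique K"
    and g1: "\<And>u. u \<in> members K \<Longrightarrow> attains w (del_at u) (g1 u)"
    and g2: "\<And>u. u \<in> members K \<Longrightarrow> attains w (keep_at 2 u) (g2 u)"
    and g3: "\<And>u. u \<in> members K \<Longrightarrow> attains w (keep_at 1 u) (g3 u)"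
begin

lemma attains_del_members: "attains w (del_members K) (\<Sum>u\<in>members K. g1 u)"
  unfolding del_members_eq[OF K] using K g1 del_at_below by (rule attains_member_pieces)

lemma attains_keep_apex: "attains w (keep_apex K) (\<Sum>u\<in>members K. min (g1 u) (g3 u))"
  unfolding keep_apex_eq[OF K]
proof (rule attains_member_pieces[OF K])
  fix u assume "u \<in> members K"
  then show "attains w (del_at u \<union> keep_at 1 u) (min (g1 u) (g3 u))" using g1 g3 attains_Un by blast
  show "S \<subseteq> below u" if "S \<in> del_at u \<union> keep_at 1 u" for S
    using that del_at_below keep_at_below by blast
qed

lemma attains_del_apex:
  defines "C \<equiv> {u \<in> members K. child_blocks u \<noteq> {}}"
  shows "attains w (del_apex K) (if C = {} then \<Sum>u\<in>members K. min (g1 u) (g3 u)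
    else min (\<Sum>u\<in>members K. min (g1 u) (g3 u)) (MIN v\<in>C. g2 v + (\<Sum>u\<in>members K - {v}. g1 u)))"
proof (cases "C = {}")
  case True
  then show ?thesis
    using attains_keep_apex unfolding keep_apex_eq[OF K] del_apex_eq[OF K] C_def[symmetric] by simp
next
  case False
  have fin: "finite C" unfolding C_def using finite_members[OF K] by simp
  have "attains w (pieces (members K) below (\<lambda>u. if u = v then keep_at 2 u else del_at u))
    (g2 v + (\<Sum>u\<in>members K - {v}. g1 u))" if "v \<in> C" for v
  proof -
    have v: "{v} \<subseteq> members K" using that unfolding C_def by blast
    have "attains w (pieces (members K) below (\<lambda>u. if u = v then keep_at 2 u else del_at u))
      (\<Sum>u\<in>members K. if u = v then g2 u else g1 u)"
    proof (rule attains_member_pieces[OF K])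
      fix u assume u: "u \<in> members K"
      show "attains w (if u = v then keep_at 2 u else del_at u) (if u = v then g2 u else g1 u)"
        using g1[OF u] g2[OF u] by (cases "u = v") simp_all
      show "S \<subseteq> below u" if "S \<in> (if u = v then keep_at 2 u else del_at u)" for S
        using that keep_at_below del_at_below by (metis (full_types))
    qed
    then show ?thesis using sum_if_split[OF finite_members[OF K] v, of g2 g1] by simp
  qed
  then have "attains w (\<Union>v\<in>C. pieces (members K) below (\<lambda>u. if u = v then keep_at 2 u else del_at u))
    (MIN v\<in>C. g2 v + (\<Sum>u\<in>members K - {v}. g1 u))"
    by (rule attains_UN[OF fin False])
  then show ?thesis
    using attains_Un[OF attains_keep_apex] False
    unfolding keep_apex_eq[OF K] del_apex_eq[OF K] C_def[symmetric] by simp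
qed

end

text \<open>At a vertex other than \<open>r\<close> exactly one block is not a child block, so the
  two summands of the local condition count all blocks, in the form used by
  \<open>claw_iff_three_cliques\<close>.\<close>

lemma claw_free_at_iff:
  assumes "v \<in> V"
  shows "claw_free_at v S \<longleftrightarrow> v \<in> S \<or> card {K. max_clique K \<and> v \<in> K \<and> \<not> K - {v} \<subseteq> S} \<le> 2"
proof -
  let ?Q = "{K \<in> child_blocks v. \<not> members K \<subseteq> S}"
  let ?H = "if v = r \<or> home v - {v} \<subseteq> S then {} else {home v}"
  have "{K. max_clique K \<and> v \<in> K \<and> \<not> K - {v} \<subseteq> S} =
    {K \<in> {K. max_clique K \<and> v \<in> K}. \<not> K - {v} \<subseteq> S}" by blast
  also have "\<dots> = {K \<in> child_blocks v. \<not> K - {v} \<subseteq> S} \<union> ?H"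
    unfolding max_cliques_at[OF assms] child_blocks_def by (auto simp del: Diff_subset_conv)
  also have "{K \<in> child_blocks v. \<not> K - {v} \<subseteq> S} = ?Q"
    unfolding child_blocks_def members_def by (rule Collect_cong) auto
  finally have eq: "{K. max_clique K \<and> v \<in> K \<and> \<not> K - {v} \<subseteq> S} = ?Q \<union> ?H" .
  have disj: "?Q \<inter> ?H = {}"
    using home_not_child[OF assms] unfolding child_blocks_def by auto
  have "card (?Q \<union> ?H) = card ?Q + card ?H"
    by (rule card_Un_disjoint[OF _ _ disj]) (simp_all add: finite_child_blocks)
  moreover have "card ?H = (if v = r \<or> home v - {v} \<subseteq> S then 0 else 1)" by simp
  ultimately show ?thesis unfolding claw_free_at_def alive_def eq by simp
qed

section \<open>The recursion computes the minimum weights\<close>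

lemma below_psubset:
  assumes "K \<in> child_blocks v" "u \<in> members K"
  shows "below u \<subset> below v"
proof
  have "below u \<subseteq> block_below K" using assms(2) unfolding block_below_def by blast
  then show "below u \<subseteq> below v" using block_below_sub_below[OF assms(1)] by blast
  have "v \<notin> below u"
    using \<open>below u \<subseteq> block_below K\<close> apex_notin_block_below child_blocksD[OF assms(1)] by blast
  then show "below u \<noteq> below v" using below_self[of v] by metis
qed

text \<open>The equations of the recursion, carried over from nodes to vertices (\<open>g1\<close>,
  \<open>g2\<close>, \<open>g3\<close>) and maximal cliques (\<open>h1\<close>, \<open>h2\<close>,
  \<open>h3\<close>), so that correctness involves neither the tree nor partial functions. Values at
  vertices are constrained only where child blocks exist, that is, at cutpoints.\<close>

context
  fixes w g1 g2 g3 :: "'a \<Rightarrow> nat" and h1 h2 h3 s :: "'a set \<Rightarrow> nat" and C :: "'a set \<Rightarrow> 'a set"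
  defines "C \<equiv> \<lambda>K. {u \<in> members K. child_blocks u \<noteq> {}}"
    and "s \<equiv> \<lambda>K. \<Sum>u\<in>{u \<in> members K. child_blocks u = {}}. w u"
  assumes g1: "\<And>v. v \<in> V \<Longrightarrow> child_blocks v \<noteq> {} \<Longrightarrow> g1 v = w v + (\<Sum>K\<in>child_blocks v. h2 K)"
    and g2: "\<And>v. v \<in> V \<Longrightarrow> child_blocks v \<noteq> {} \<Longrightarrow>
      g2 v = (if card (child_blocks v) \<le> 2 then \<Sum>K\<in>child_blocks v. h3 K
        else MIN a\<in>child_blocks v. MIN b\<in>child_blocks v.
          (\<Sum>K\<in>{a, b}. h3 K) + (\<Sum>K\<in>child_blocks v - {a, b}. h1 K))"
    and g3: "\<And>v. v \<in> V \<Longrightarrow> child_blocks v \<noteq> {} \<Longrightarrow>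
      g3 v = (if is_singleton (child_blocks v) then h3 (the_elem (child_blocks v))
        else MIN a\<in>child_blocks v. h3 a + (\<Sum>K\<in>child_blocks v - {a}. h1 K))"
    and h1: "\<And>K. max_clique K \<Longrightarrow> h1 K = s K + (\<Sum>u\<in>C K. g1 u)"
    and h2: "\<And>K. max_clique K \<Longrightarrow>
      h2 K = (if C K = {} then 0 else min (\<Sum>u\<in>C K. min (g1 u) (g3 u))
        (MIN v\<in>C K. s K + g2 v + (\<Sum>u\<in>C K - {v}. g1 u)))"
    and h3: "\<And>K. max_clique K \<Longrightarrow> h3 K = (\<Sum>u\<in>C K. min (g1 u) (g3 u))"
begin

lemma attains_blocks:
  assumes K: "max_clique K"
    and IH: "\<And>u. u \<in> C K \<Longrightarrow>
      attains w (del_at u) (g1 u) \<and> attains w (keep_at 2 u) (g2 u) \<and> attains w (keep_at 1 u) (g3 u)"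
  shows "attains w (del_members K) (h1 K) \<and> attains w (del_apex K) (h2 K) \<and> attains w (keep_apex K) (h3 K)"
proof -
  \<comment> \<open>At members without child blocks the leaf values \<open>w u\<close>, 0, 0 fill in
    for the recursion. Their weights add up to \<open>s K\<close>, and
    \<open>min (w u) 0 = 0\<close> drops out of the sums of minima.\<close>
  define f1 where "f1 u = (if child_blocks u = {} then w u else g1 u)" for u
  define f2 where "f2 u = (if child_blocks u = {} then 0 else g2 u)" for u
  define f3 where "f3 u = (if child_blocks u = {} then 0 else g3 u)" for u
  have C: "C K = {u \<in> members K. child_blocks u \<noteq> {}}" unfolding C_def ..
  have att: "attains w (del_at u) (f1 u)" "attains w (keep_at 2 u) (f2 u)" "attains w (keep_at 1 u) (f3 u)"
    if "u \<in> members K" for u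
  proof -
    have "attains w (del_at u) (f1 u) \<and> attains w (keep_at 2 u) (f2 u) \<and> attains w (keep_at 1 u) (f3 u)"
    proof (cases "child_blocks u = {}")
      case True
      then show ?thesis
        unfolding f1_def f2_def f3_def by (simp add: attains_del_at_leaf attains_keep_at_leaf)
    next
      case False
      then have "u \<in> C K" using that unfolding C by simp
      then show ?thesis using IH[of u] False unfolding f1_def f2_def f3_def by simp
    qed
    then show "attains w (del_at u) (f1 u)" "attains w (keep_at 2 u) (f2 u)" "attains w (keep_at 1 u) (f3 u)"
      by simp_all
  qed
  have fin: "finite (members K)" using finite_members[OF K] .
  have split: "sum f (members K - Q) = sum f {u \<in> members K. child_blocks u = {}} + sum f (C K - Q)"
    if "Q \<subseteq> C K" for f :: "'a \<Rightarrow> nat" and Q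
  proof -
    have "members K - Q = {u \<in> members K. child_blocks u = {}} \<union> (C K - Q)" using that unfolding C by auto
    also have "sum f \<dots> = sum f {u \<in> members K. child_blocks u = {}} + sum f (C K - Q)"
      using fin unfolding C by (intro sum.union_disjoint) auto
    finally show ?thesis .
  qed
  have s1: "sum f1 (members K - Q) = s K + sum g1 (C K - Q)" if "Q \<subseteq> C K" for Q
  proof -
    have "sum f1 {u \<in> members K. child_blocks u = {}} = s K" unfolding s_def f1_def by (rule sum.cong) auto
    moreover have "sum f1 (C K - Q) = sum g1 (C K - Q)" unfolding C f1_def by (rule sum.cong) auto
    ultimately show ?thesis using split[OF that] by simp
  qed
  have s3: "(\<Sum>u\<in>members K. min (f1 u) (f3 u)) = (\<Sum>u\<in>C K. min (g1 u) (g3 u))"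
  proof -
    have "(\<Sum>u\<in>{u \<in> members K. child_blocks u = {}}. min (f1 u) (f3 u)) = 0" unfolding f3_def by simp
    moreover have "(\<Sum>u\<in>C K. min (f1 u) (f3 u)) = (\<Sum>u\<in>C K. min (g1 u) (g3 u))"
      unfolding C f1_def f3_def by (rule sum.cong) auto
    ultimately show ?thesis using split[of "{}" "\<lambda>u. min (f1 u) (f3 u)"] by simp
  qed
  have "attains w (del_members K) (h1 K)"
    using attains_del_members[OF K att] s1[of "{}"] h1[OF K] by simp
  moreover have "attains w (keep_apex K) (h3 K)"
    using attains_keep_apex[OF K att] s3 h3[OF K] by simp
  moreover have "attains w (del_apex K) (h2 K)"
  proof -
    have "f2 v + sum f1 (members K - {v}) = s K + g2 v + sum g1 (C K - {v})" if "v \<in> C K" for v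
      using s1[of "{v}"] that unfolding f2_def C by simp
    then have "(MIN v\<in>C K. f2 v + sum f1 (members K - {v})) = (MIN v\<in>C K. s K + g2 v + sum g1 (C K - {v}))"
      by (intro arg_cong[where f = Min] image_cong) auto
    then show ?thesis
      using attains_del_apex[OF K att] unfolding C[symmetric] s3 h2[OF K] by (simp split: if_splits)
  qed
  ultimately show ?thesis by blast
qed

text \<open>One induction step descends two levels of the tree: from \<open>v\<close> through a
  child block to its members, whose subtrees are strictly smaller.\<close>

lemma attains_cut:
  assumes "v \<in> V" "child_blocks v \<noteq> {}"
  shows "attains w (del_at v) (g1 v) \<and> attains w (keep_at 2 v) (g2 v) \<and> attains w (keep_at 1 v) (g3 v)"
  using assms
proof (induction "card (below v)" arbitrary: v rule: less_induct)
  case less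
  have blocks: "attains w (del_members K) (h1 K) \<and> attains w (del_apex K) (h2 K) \<and> attains w (keep_apex K) (h3 K)"
    if K: "K \<in> child_blocks v" for K
  proof (rule attains_blocks[OF child_blocksD(1)[OF K]])
    fix u assume u: "u \<in> C K"
    then have m: "u \<in> members K" "child_blocks u \<noteq> {}" unfolding C_def by simp_all
    show "attains w (del_at u) (g1 u) \<and> attains w (keep_at 2 u) (g2 u) \<and> attains w (keep_at 1 u) (g3 u)"
    proof (rule less.hyps)
      show "card (below u) < card (below v)"
        by (rule psubset_card_mono[OF finite_below[OF less.prems(1)] below_psubset[OF K m(1)]])
      show "u \<in> V" using members_V[OF child_blocksD(1)[OF K] m(1)] .
    qed (rule m(2))
  qed
  then show ?case
    unfolding g1[OF less.prems] g2[OF less.prems] g3[OF less.prems]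
    by (intro conjI attains_del_at attains_keep_at_two attains_keep_at_one less.prems(2)) simp_all
qed

theorem attains_claw_free:
  assumes "child_blocks r \<noteq> {}"
  shows "attains w {S. S \<subseteq> V \<and> (\<forall>v\<in>V. claw_free_at v S)} (min (g1 r) (g2 r))"
proof -
  have "(\<forall>v\<in>V. claw_free_at v S) \<longleftrightarrow> (r \<in> S \<or> alive r S \<le> 2) \<and> (\<forall>v\<in>V - {r}. claw_free_at v S)" for S
    using r_in unfolding claw_free_at_def[of r] by (auto simp: claw_free_at_def[of r])
  \<comment> \<open>The root has no block above, so both blocks of its budget may be child blocks;
    hence \<open>keep_at 2\<close>, and \<open>f3\<close> does not occur at
    \<open>r\<close>.\<close>
  then have "{S. S \<subseteq> V \<and> (\<forall>v\<in>V. claw_free_at v S)} = del_at r \<union> keep_at 2 r"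
    unfolding del_at_def keep_at_def below_root by blast
  then show ?thesis using attains_Un[of w "del_at r" "g1 r" "keep_at 2 r"] attains_cut[OF r_in assms] by presburger
qed

end

end

section \<open>Cutpoints, blocks and claws\<close>

lemma connected_iff_rtrancl:
  assumes "graph H"
  shows "Digraph_Component.connected H \<longleftrightarrow>
    verts H \<noteq> {} \<and> (\<forall>x\<in>verts H. \<forall>y\<in>verts H. (x, y) \<in> (arcs_ends H)\<^sup>*)"
proof -
  interpret graph H by fact
  have "(arcs_ends H)\<^sup>s = arcs_ends H"
    using sym_arcs unfolding symmetric_def symcl_def sym_def by auto
  then have "Digraph_Component.connected H \<longleftrightarrow> strongly_connected H"
    unfolding connected_conv strongly_connected_def reachable_def by simp
  then show ?thesis unfolding strongly_connected_def using reachable_conv' by auto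
qed

lemma arcs_ends_del_vert:
  assumes "wf_digraph H"
  shows "arcs_ends (pre_digraph.del_vert H v) = arcs_ends H \<inter> (verts H - {v}) \<times> (verts H - {v})"
proof -
  interpret wf_digraph H by fact
  show ?thesis unfolding arcs_ends_conv by (auto simp: del_vert_simps)
qed

text \<open>A connected graph has one component, so the definition asks for at least two after
  deleting \<open>v\<close>; deleting the only vertex leaves none.\<close>

lemma cutpoint_iff:
  assumes H: "graph H" and conn: "Digraph_Component.connected H"
  shows "cutpoint H v \<longleftrightarrow> v \<in> verts H \<and> (\<exists>x\<in>verts H - {v}. \<exists>y\<in>verts H - {v}.
    (x, y) \<notin> (arcs_ends H \<inter> (verts H - {v}) \<times> (verts H - {v}))\<^sup>*)"
proof -
  interpret graph H by fact
  let ?D = "del_vert v" and ?R = "(arcs_ends H \<inter> (verts H - {v}) \<times> (verts H - {v}))\<^sup>*"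
  have "strongly_connected H" using symmetric_connected_imp_strongly_connected[OF sym_arcs conn] .
  then have one: "card sccs = 1" unfolding strongly_connected_eq_iff by simp
  interpret D: fin_digraph ?D by (rule fin_digraph_del_vert)
  have verts_D: "verts ?D = verts H - {v}" by (simp add: verts_del_vert)
  have sym_R: "sym ?R"
    using sym_arcs unfolding symmetric_def by (intro sym_rtrancl) (auto simp: sym_def)
  have reach: "x \<rightarrow>\<^sup>*\<^bsub>?D\<^esub> y \<longleftrightarrow> (x, y) \<in> ?R" if "x \<in> verts H - {v}" for x y
    using D.reachable_conv'[of x y] that unfolding verts_D arcs_ends_del_vert[OF wf_digraph] by simp
  have card_D: "card D.sccs = card (D.scc_of ` (verts H - {v}))"
    using D.card_sccs_verts unfolding D.sccs_verts_conv_scc_of verts_D by simp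
  have scc: "D.scc_of x = {y \<in> verts H - {v}. (x, y) \<in> ?R}" if "x \<in> verts H - {v}" for x
  proof -
    have "y \<in> verts H - {v}" if "x \<rightarrow>\<^sup>*\<^bsub>?D\<^esub> y" for y
      using D.reachable_in_verts(2)[OF that] verts_D by simp
    moreover have "(y, x) \<in> ?R" if "(x, y) \<in> ?R" for y using symD[OF sym_R that] .
    ultimately show ?thesis using reach that unfolding D.scc_of_def by blast
  qed
  have "1 < card D.sccs \<longleftrightarrow> (\<exists>x\<in>verts H - {v}. \<exists>y\<in>verts H - {v}. (x, y) \<notin> ?R)"
  proof
    assume L: "1 < card D.sccs"
    show "\<exists>x\<in>verts H - {v}. \<exists>y\<in>verts H - {v}. (x, y) \<notin> ?R"
    proof (rule ccontr)
      assume "\<not> ?thesis"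
      then have "D.scc_of x = verts H - {v}" if "x \<in> verts H - {v}" for x using scc that by blast
      then have "D.scc_of ` (verts H - {v}) \<subseteq> {verts H - {v}}" by blast
      then have "card D.sccs \<le> 1" unfolding card_D using card_mono[of "{verts H - {v}}"] by fastforce
      then show False using L by simp
    qed
  next
    assume "\<exists>x\<in>verts H - {v}. \<exists>y\<in>verts H - {v}. (x, y) \<notin> ?R"
    then obtain x y where xy: "x \<in> verts H - {v}" "y \<in> verts H - {v}" "(x, y) \<notin> ?R" by blast
    have "y \<in> D.scc_of y" "y \<notin> D.scc_of x" using scc[OF xy(1)] scc[OF xy(2)] xy by blast+
    then have "card {D.scc_of x, D.scc_of y} = 2" by (metis card_2_iff)
    moreover have "card {D.scc_of x, D.scc_of y} \<le> card D.sccs"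
      unfolding card_D using xy by (intro card_mono) auto
    ultimately show "1 < card D.sccs" by simp
  qed
  then show ?thesis unfolding cutpoint_def one by blast
qed

section \<open>Two-connected subgraphs, cliques and cycles\<close>

context graph
begin

abbreviation (input) adj :: "('a \<times> 'a) set" where "adj \<equiv> arcs_ends G"

lemma adj_verts: "adj \<subseteq> verts G \<times> verts G"
  unfolding arcs_ends_conv by auto

lemma sym_adj: "sym adj"
  using sym_arcs unfolding symmetric_def .

lemma graph_induce:
  assumes "U \<subseteq> verts G"
  shows "graph (G \<restriction> U)"
proof -
  have ind: "induced_subgraph (G \<restriction> U) G" using induced_induce[OF assms] .
  interpret I: digraph "G \<restriction> U" by (rule digraphI_induced[OF ind])
  show ?thesis using induced_graph_imp_symmetric[OF sym_arcs ind] by (rule I.graphI)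
qed

lemma arcs_ends_induce: "arcs_ends (G \<restriction> U) = adj \<inter> U \<times> U"
  unfolding arcs_ends_conv by auto

lemma two_connected_induce:
  assumes U: "U \<subseteq> verts G" "U \<noteq> {}"
    and conn: "\<And>x y. x \<in> U \<Longrightarrow> y \<in> U \<Longrightarrow> (x, y) \<in> (adj \<inter> U \<times> U)\<^sup>*"
    and conn_del: "\<And>v x y. v \<in> U \<Longrightarrow> x \<in> U - {v} \<Longrightarrow> y \<in> U - {v} \<Longrightarrow>
      (x, y) \<in> (adj \<inter> (U - {v}) \<times> (U - {v}))\<^sup>*"
  shows "two_connected (G \<restriction> U)"
proof -
  have g: "graph (G \<restriction> U)" using graph_induce[OF U(1)] .
  have c: "Digraph_Component.connected (G \<restriction> U)"
    unfolding connected_iff_rtrancl[OF g] arcs_ends_induce using U(2) conn by simp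
  have "adj \<inter> U \<times> U \<inter> (U - {v}) \<times> (U - {v}) = adj \<inter> (U - {v}) \<times> (U - {v})" for v by blast
  then have "\<not> cutpoint (G \<restriction> U) v" for v
    unfolding cutpoint_iff[OF g c] arcs_ends_induce using conn_del by simp
  then show ?thesis unfolding two_connected_def using g c by blast
qed

lemma subgraph_eqI:
  assumes "subgraph H H'" "verts H' = verts H" "arcs H' = arcs H"
  shows "H' = H"
  using assms unfolding subgraph_def compatible_def by (intro pre_digraph.equality) auto

text \<open>A two-connected subgraph containing \<open>H\<close> with the most vertices and arcs is
  maximal. Arcs are counted too, since a larger subgraph may have the same vertices.\<close>

lemma two_connected_in_block:
  assumes H: "two_connected H" "subgraph H G"
  obtains B where "block G B" "subgraph H B"
proof -
  let ?P = "\<lambda>B. subgraph H B \<and> subgraph B G \<and> two_connected B"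
  let ?m = "\<lambda>B. card (verts B) + card (arcs B)"
  have "wf_digraph H" using H(2) unfolding subgraph_def by simp
  then have "?P H" using H wf_digraph.subgraph_refl by blast
  moreover have "\<forall>B. ?P B \<longrightarrow> ?m B < Suc (card (verts G) + card (arcs G))"
  proof (intro allI impI)
    fix B assume "?P B"
    then have "verts B \<subseteq> verts G" "arcs B \<subseteq> arcs G" unfolding subgraph_def by simp_all
    then show "?m B < Suc (card (verts G) + card (arcs G))"
      using card_mono[OF finite_verts] card_mono[OF finite_arcs] by (simp add: add_mono less_Suc_eq_le)
  qed
  ultimately obtain B where B: "?P B" "\<And>B'. ?P B' \<Longrightarrow> ?m B' \<le> ?m B"
    using ex_has_greatest_nat[of ?P H ?m] by blast
  have "B' = B" if B': "subgraph B B'" "subgraph B' G" "two_connected B'" for B'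
  proof -
    have sub: "verts B \<subseteq> verts B'" "arcs B \<subseteq> arcs B'" using B' unfolding subgraph_def by simp_all
    have fin: "finite (verts B')" "finite (arcs B')"
      using B'(2) finite_verts finite_arcs finite_subset unfolding subgraph_def by blast+
    have "?m B' \<le> ?m B" using B(1) B' subgraph_trans by (intro B(2)) blast
    then have "card (verts B') = card (verts B)" "card (arcs B') = card (arcs B)"
      using card_mono[OF fin(1) sub(1)] card_mono[OF fin(2) sub(2)] by linarith+
    then have "verts B' = verts B" "arcs B' = arcs B"
      using card_subset_eq[OF fin(1) sub(1)] card_subset_eq[OF fin(2) sub(2)] by simp_all
    then show ?thesis by (rule subgraph_eqI[OF B'(1)])
  qed
  then have "block G B" unfolding block_def max_subgraph_def using B(1) by blast
  then show ?thesis using that B(1) by blast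
qed

lemma clique_two_connected:
  assumes "U \<subseteq> verts G" "U \<noteq> {}" "\<And>x y. x \<in> U \<Longrightarrow> y \<in> U \<Longrightarrow> x \<noteq> y \<Longrightarrow> (x, y) \<in> adj"
  shows "two_connected (G \<restriction> U)"
proof (rule two_connected_induce[OF assms(1,2)])
  have *: "(x, y) \<in> (adj \<inter> W \<times> W)\<^sup>*" if "x \<in> W" "y \<in> W" "W \<subseteq> U" for x y W
    using assms(3)[of x y] that by (cases "x = y") auto
  show "(x, y) \<in> (adj \<inter> U \<times> U)\<^sup>*" if "x \<in> U" "y \<in> U" for x y
    by (rule *[OF that]) simp
  show "(x, y) \<in> (adj \<inter> (U - {v}) \<times> (U - {v}))\<^sup>*" if "x \<in> U - {v}" "y \<in> U - {v}" for v x y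
    by (rule *[OF that]) blast
qed

lemma cycle_verts:
  assumes xs: "is_path adj xs" "(last xs, hd xs) \<in> adj"
  shows "set xs \<subseteq> verts G"
proof
  fix x assume "x \<in> set xs"
  then obtain as bs where ab: "xs = as @ x # bs" by (auto simp: in_set_conv_decomp)
  show "x \<in> verts G"
  proof (cases "bs = []")
    case True
    then show ?thesis using xs(2) ab adj_verts by auto
  next
    case False
    then have "(x, hd bs) \<in> adj" using xs(1) ab by (simp add: successively_append_iff successively_Cons)
    then show ?thesis using adj_verts by auto
  qed
qed

text \<open>Deleting \<open>v\<close> from the cyclic sequence \<open>as @ v # bs\<close> leaves the
  path \<open>bs @ as\<close>, held together by the closing edge.\<close>

lemma cycle_two_connected:
  assumes xs: "distinct xs" "3 \<le> length xs" "is_path adj xs" "(last xs, hd xs) \<in> adj"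
  shows "two_connected (G \<restriction> set xs)"
proof (rule two_connected_induce)
  show "set xs \<noteq> {}" using xs(2) by auto
  show "set xs \<subseteq> verts G" using cycle_verts[OF xs(3,4)] .
  show "(x, y) \<in> (adj \<inter> set xs \<times> set xs)\<^sup>*" if "x \<in> set xs" "y \<in> set xs" for x y
    using path_imp_rtrancl[OF xs(3) sym_adj subset_refl that] .
  show "(x, y) \<in> (adj \<inter> (set xs - {v}) \<times> (set xs - {v}))\<^sup>*"
    if "v \<in> set xs" "x \<in> set xs - {v}" "y \<in> set xs - {v}" for v x y
  proof -
    from split_list[OF that(1)] obtain as bs where ab: "xs = as @ v # bs" by blast
    have "is_path adj (bs @ as)"
    proof (cases "as = [] \<or> bs = []")
      case True
      then show ?thesis using xs(3) ab by (auto simp: successively_append_iff successively_Cons)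
    next
      case False
      then have "(last bs, hd as) \<in> adj" using xs(4) ab by simp
      then show ?thesis using xs(3) ab by (auto simp: successively_append_iff successively_Cons)
    qed
    moreover have "set xs - {v} = set (bs @ as)" using xs(1) ab by auto
    ultimately show ?thesis using path_imp_rtrancl[of adj "bs @ as" _ x y] sym_adj that by simp
  qed
qed

end

section \<open>Connected block graphs as rooted block graphs\<close>

locale connected_block_graph = graph G for G :: "('a, 'b) pre_digraph" +
  fixes r :: 'a
  assumes block_graph: "block_graph G" and connected: "Digraph_Component.connected G"
    and cutpoint_r: "cutpoint G r"
begin

text \<open>As \<open>G\<close> has no parallel arcs, completeness of \<open>B\<close> means that
  \<open>B\<close> already has every arc of \<open>G\<close> between its vertices. So
  \<open>B\<close> is induced and can be identified with its vertex set.\<close>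

lemma block_complete:
  assumes "block G B"
  shows "arcs_ends B = {(u, v). u \<in> verts B \<and> v \<in> verts B \<and> u \<noteq> v}" "verts B \<subseteq> verts G"
    "arcs_ends B \<subseteq> adj" "B = G \<restriction> verts B"
proof -
  have "complete_graph B" using block_graph assms unfolding block_graph_def by blast
  then show ends: "arcs_ends B = {(u, v). u \<in> verts B \<and> v \<in> verts B \<and> u \<noteq> v}"
    unfolding complete_digraph_def by auto
  have sub: "subgraph B G" using assms unfolding block_def max_subgraph_def by blast
  then have B: "verts B \<subseteq> verts G" "arcs B \<subseteq> arcs G" "wf_digraph B" "tail B = tail G" "head B = head G"
    unfolding subgraph_def compatible_def by simp_all
  then show "verts B \<subseteq> verts G" "arcs_ends B \<subseteq> adj" unfolding arcs_ends_conv by auto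
  have "arcs B = {e \<in> arcs G. tail G e \<in> verts B \<and> head G e \<in> verts B}"
  proof (intro set_eqI iffI)
    fix e assume "e \<in> arcs B"
    then show "e \<in> {e \<in> arcs G. tail G e \<in> verts B \<and> head G e \<in> verts B}"
      using B wf_digraph.tail_in_verts[OF B(3)] wf_digraph.head_in_verts[OF B(3)] by auto
  next
    fix e assume e: "e \<in> {e \<in> arcs G. tail G e \<in> verts B \<and> head G e \<in> verts B}"
    then have "(tail G e, head G e) \<in> arcs_ends B" unfolding ends using no_loops by simp
    then obtain e' where e': "e' \<in> arcs B" "tail G e' = tail G e" "head G e' = head G e"
      unfolding arcs_ends_conv using B by auto
    then have "e' = e" using e B(2) by (intro no_multi_arcs) (auto simp: arc_to_ends_def)
    then show "e \<in> arcs B" using e' by simp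
  qed
  then show "B = G \<restriction> verts B" using B by (intro pre_digraph.equality) simp_all
qed

sublocale rooted_block_graph "verts G" "arcs_ends G" r
proof
  show "finite (verts G)" by simp
  show "adj \<subseteq> verts G \<times> verts G" by (rule adj_verts)
  show "sym adj" by (rule sym_adj)
  show "(x, x) \<notin> adj" for x using adj_not_same by blast
  show r: "r \<in> verts G" using cutpoint_r unfolding cutpoint_def by blast
  have gr: "graph G" by unfold_locales
  show "(r, v) \<in> adj\<^sup>*" if "v \<in> verts G" for v
    using connected r that unfolding connected_iff_rtrancl[OF gr] by blast
  fix xs x y
  assume xs: "distinct xs" "3 \<le> length xs" "is_path adj xs" "(last xs, hd xs) \<in> adj"
    and xy: "x \<in> set xs" "y \<in> set xs" "x \<noteq> y"
  have tc: "two_connected (G \<restriction> set xs)" using cycle_two_connected[OF xs] .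
  have "subgraph (G \<restriction> set xs) G" using cycle_verts[OF xs(3,4)] by (rule subgraph_induce_subgraphI)
  then obtain B where B: "block G B" "subgraph (G \<restriction> set xs) B" using two_connected_in_block[OF tc] by blast
  have "x \<in> verts B" "y \<in> verts B" using B(2) xy unfolding subgraph_def by auto
  then show "(x, y) \<in> adj" using block_complete(1,3)[OF B(1)] xy(3) by auto
qed

lemma block_clique: "block G B \<Longrightarrow> clique (verts B)"
  using block_complete(1,2,3)[of B] unfolding clique_def by blast

text \<open>Maximality as a subgraph is played against maximality as a clique: a nonempty clique is
  two-connected and so lies in a block, and the vertices of a block form a clique.\<close>

lemma block_iff: "block G B \<longleftrightarrow> (\<exists>K. max_clique K \<and> B = G \<restriction> K)"
proof
  assume B: "block G B"
  have "K = verts B" if K: "clique K" "verts B \<subseteq> K" for K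
  proof -
    have KV: "K \<subseteq> verts G" using K(1) unfolding clique_def by blast
    have "two_connected B" using B unfolding block_def max_subgraph_def by blast
    then have "verts B \<noteq> {}" unfolding two_connected_def using connected_iff_rtrancl by blast
    then have tc: "two_connected (G \<restriction> K)"
      using K KV unfolding clique_def by (intro clique_two_connected) blast+
    have "subgraph (G \<restriction> verts B) (G \<restriction> K)"
      using K(2) wellformed_induce_subgraph unfolding subgraph_def compatible_def by auto
    then have "subgraph B (G \<restriction> K)" using block_complete(4)[OF B] by simp
    then have "G \<restriction> K = B"
      using B tc subgraph_induce_subgraphI[OF KV] unfolding block_def max_subgraph_def by blast
    then show ?thesis using induce_subgraph_verts[of G K] by simp
  qed
  then have "max_clique (verts B)" unfolding max_clique_def using block_clique[OF B] by blast
  then show "\<exists>K. max_clique K \<and> B = G \<restriction> K" using block_complete(4)[OF B] by blast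
next
  assume "\<exists>K. max_clique K \<and> B = G \<restriction> K"
  then obtain K where K: "max_clique K" "B = G \<restriction> K" by blast
  have KV: "K \<subseteq> verts G" "K \<noteq> {}" using max_clique_sub[OF K(1)] apex_in[OF K(1)] by blast+
  have "two_connected (G \<restriction> K)"
    using KV max_clique_edge[OF K(1)] by (rule clique_two_connected)
  then obtain B' where B': "block G B'" "subgraph (G \<restriction> K) B'"
    using two_connected_in_block subgraph_induce_subgraphI[OF KV(1)] by blast
  have "K \<subseteq> verts B'" using B'(2) unfolding subgraph_def by simp
  then have "verts B' = K" using K(1) block_clique[OF B'(1)] unfolding max_clique_def by blast
  then have "B' = B" using block_complete(4)[OF B'(1)] K(2) by simp
  then show "block G B" using B'(1) by simp
qed

lemma cutpoint_iff_cliques: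
  "cutpoint G v \<longleftrightarrow> (\<exists>K L. max_clique K \<and> max_clique L \<and> K \<noteq> L \<and> v \<in> K \<and> v \<in> L)"
proof -
  have gr: "graph G" by unfold_locales
  show ?thesis
  proof
    assume "cutpoint G v"
    then show "\<exists>K L. max_clique K \<and> max_clique L \<and> K \<noteq> L \<and> v \<in> K \<and> v \<in> L"
      unfolding cutpoint_iff[OF gr connected] using one_clique_connected[of v] by blast
  next
    assume "\<exists>K L. max_clique K \<and> max_clique L \<and> K \<noteq> L \<and> v \<in> K \<and> v \<in> L"
    then obtain K L where KL: "max_clique K" "max_clique L" "K \<noteq> L" "v \<in> K" "v \<in> L" by blast
    then have "v \<in> verts G" using max_clique_sub by blast
    then show "cutpoint G v"
      unfolding cutpoint_iff[OF gr connected] using two_cliques_separate[OF KL] by blast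
  qed
qed

text \<open>A cutpoint lies in two blocks. Off the root one block at \<open>v\<close> is the block
  above, so a second one must be a child block; at the root all blocks are child blocks.\<close>

lemma cutpoint_iff_child_blocks:
  assumes "v \<in> verts G"
  shows "cutpoint G v \<longleftrightarrow> child_blocks v \<noteq> {}"
proof (cases "v = r")
  case True
  have "{K. max_clique K \<and> v \<in> K} = child_blocks v"
    using max_cliques_at[OF assms] True unfolding child_blocks_def by simp
  moreover have "cutpoint G v" using True cutpoint_r by simp
  ultimately show ?thesis unfolding cutpoint_iff_cliques by blast
next
  case False
  have at: "{K. max_clique K \<and> v \<in> K} = insert (home v) (child_blocks v)"
    using max_cliques_at[OF assms] False unfolding child_blocks_def by simp
  have h: "home v \<notin> child_blocks v" using home_not_child[OF assms False] unfolding child_blocks_def by simp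
  show ?thesis unfolding cutpoint_iff_cliques
  proof
    assume "\<exists>K L. max_clique K \<and> max_clique L \<and> K \<noteq> L \<and> v \<in> K \<and> v \<in> L"
    then obtain K L where KL: "K \<in> {K. max_clique K \<and> v \<in> K}" "L \<in> {K. max_clique K \<and> v \<in> K}" "K \<noteq> L"
      by blast
    then show "child_blocks v \<noteq> {}" unfolding at by blast
  next
    assume "child_blocks v \<noteq> {}"
    then obtain K where "K \<in> child_blocks v" by blast
    then have "K \<in> {K. max_clique K \<and> v \<in> K}" "home v \<in> {K. max_clique K \<and> v \<in> K}" "K \<noteq> home v"
      unfolding at using h by blast+
    then show "\<exists>K L. max_clique K \<and> max_clique L \<and> K \<noteq> L \<and> v \<in> K \<and> v \<in> L" by blast
  qed
qed

lemma claw_iff: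
  assumes U: "U \<subseteq> verts G"
  shows "(\<exists>H. induced_subgraph H (G \<restriction> U) \<and> complete_bipartite_digraph 1 3 H) \<longleftrightarrow>
    (\<exists>c\<in>U. \<exists>A\<subseteq>U. card A = 3 \<and> (\<forall>a\<in>A. (c, a) \<in> adj) \<and> (\<forall>a\<in>A. \<forall>b\<in>A. (a, b) \<notin> adj))"
proof
  assume "\<exists>H. induced_subgraph H (G \<restriction> U) \<and> complete_bipartite_digraph 1 3 H"
  then obtain H X A where H: "induced_subgraph H (G \<restriction> U)" "verts H = X \<union> A" "X \<inter> A = {}"
    "card X = 1" "card A = 3" "arcs_ends H = X \<times> A \<union> A \<times> X"
    unfolding complete_bipartite_digraph_def by blast
  obtain c where c: "X = {c}" using H(4) by (rule card_1_singletonE)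
  have sub: "verts H \<subseteq> U" "tail H = tail G" "head H = head G"
    "arcs H = {e \<in> arcs G. tail G e \<in> verts H \<and> head G e \<in> verts H}"
    using H(1) unfolding induced_subgraph_def subgraph_def compatible_def by auto
  have "arcs_ends H = adj \<inter> verts H \<times> verts H"
    unfolding arcs_ends_conv using sub by auto
  then have eq: "X \<times> A \<union> A \<times> X = adj \<inter> (X \<union> A) \<times> (X \<union> A)" using H(2,6) by simp
  have "(c, a) \<in> adj" if "a \<in> A" for a using eq that c by blast
  moreover have "(a, b) \<notin> adj" if "a \<in> A" "b \<in> A" for a b using eq that H(3) by blast
  ultimately show "\<exists>c\<in>U. \<exists>A\<subseteq>U. card A = 3 \<and> (\<forall>a\<in>A. (c, a) \<in> adj) \<and> (\<forall>a\<in>A. \<forall>b\<in>A. (a, b) \<notin> adj)"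
    using sub(1) H(2,5) c by blast
next
  assume "\<exists>c\<in>U. \<exists>A\<subseteq>U. card A = 3 \<and> (\<forall>a\<in>A. (c, a) \<in> adj) \<and> (\<forall>a\<in>A. \<forall>b\<in>A. (a, b) \<notin> adj)"
  then obtain c A where cA: "c \<in> U" "A \<subseteq> U" "card A = 3" "\<And>a. a \<in> A \<Longrightarrow> (c, a) \<in> adj"
    "\<And>a b. a \<in> A \<Longrightarrow> b \<in> A \<Longrightarrow> (a, b) \<notin> adj" by blast
  have c: "(c, c) \<notin> adj" "c \<notin> A" using irrefl_E cA(4) by blast+
  let ?H = "G \<restriction> insert c A"
  have ca: "(a, c) \<in> adj" if "a \<in> A" for a using symD[OF sym_adj cA(4)[OF that]] .
  have "arcs_ends ?H = {c} \<times> A \<union> A \<times> {c}"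
    unfolding arcs_ends_induce using cA(4,5) c ca by blast
  moreover have "graph ?H" using cA U by (intro graph_induce) blast
  ultimately have "complete_bipartite_digraph 1 3 ?H"
    unfolding complete_bipartite_digraph_def using cA(3) c(2)
    by (intro conjI exI[of _ "{c}"] exI[of _ A]) simp_all
  moreover have "induced_subgraph ?H (G \<restriction> U)"
    using cA(1,2) wellformed_induce_subgraph
    unfolding induced_subgraph_def subgraph_def compatible_def by auto
  ultimately show "\<exists>H. induced_subgraph H (G \<restriction> U) \<and> complete_bipartite_digraph 1 3 H" by blast
qed

lemma claw_deletion_set_iff:
  "claw_deletion_set G S \<longleftrightarrow> S \<subseteq> verts G \<and> (\<forall>v\<in>verts G. claw_free_at v S)"
proof (cases "S \<subseteq> verts G")
  case True
  have Q: "{K. max_clique K \<and> c \<in> K \<and> (K - {c}) \<inter> (verts G - S) \<noteq> {}} =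
    {K. max_clique K \<and> c \<in> K \<and> \<not> K - {c} \<subseteq> S}" for c
  proof (intro Collect_cong conj_cong refl)
    fix K assume "max_clique K" "c \<in> K"
    then show "(K - {c}) \<inter> (verts G - S) \<noteq> {} \<longleftrightarrow> \<not> K - {c} \<subseteq> S"
      using max_clique_sub[of K] by blast
  qed
  have "(\<exists>H. induced_subgraph H (G \<restriction> (verts G - S)) \<and> complete_bipartite_digraph 1 3 H) \<longleftrightarrow>
    (\<exists>c\<in>verts G - S. 3 \<le> card {K. max_clique K \<and> c \<in> K \<and> \<not> K - {c} \<subseteq> S})"
    unfolding claw_iff[OF Diff_subset] claw_iff_three_cliques[OF Diff_subset] Q ..
  moreover have "claw_free_at v S \<longleftrightarrow> v \<in> S \<or> \<not> 3 \<le> card {K. max_clique K \<and> v \<in> K \<and> \<not> K - {v} \<subseteq> S}"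
    if "v \<in> verts G" for v
    unfolding claw_free_at_iff[OF that] by linarith
  ultimately show ?thesis unfolding claw_deletion_set_def using True by blast
qed (simp add: claw_deletion_set_def)

end

section \<open>The block-cutpoint-tree\<close>

text \<open>\<open>D\<close> plays the arcs directed away from the root. A simple path from the root
  cannot turn upwards, because the only way up from a node is the arc by which it was
  reached.\<close>

lemma children_eq_down_arcs:
  fixes T :: "'n pair_pre_digraph" and D :: "('n \<times> 'n) set" and L :: "'n \<Rightarrow> nat"
  assumes wf: "parcs T \<subseteq> pverts T \<times> pverts T"
    and arcs: "parcs T = D \<union> D\<inverse>"
    and L: "\<And>x y. (x, y) \<in> D \<Longrightarrow> L y = Suc (L x)"
    and unique: "\<And>x x' y. (x, y) \<in> D \<Longrightarrow> (x', y) \<in> D \<Longrightarrow> x = x'"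
    and root: "\<rho> \<in> pverts T" "\<And>x. (x, \<rho>) \<notin> D"
    and parent: "\<And>y. y \<in> pverts T \<Longrightarrow> y \<noteq> \<rho> \<Longrightarrow> \<exists>x. (x, y) \<in> D"
  shows "children T \<rho> x = {y. (x, y) \<in> D}"
proof -
  interpret wf_digraph "with_proj T" by unfold_locales (use wf in auto)
  note [simp del] = awalk_verts_with_proj_eq cas_with_proj_eq
  \<comment> \<open>The premise that the path avoids the predecessors of its start is inherited by
    the tail: the only predecessor of \<open>b\<close> is \<open>z\<close>, to which a simple path
    does not return.\<close>
  have down: "set p \<subseteq> D" if "apath z p y" "\<And>t. (t, z) \<in> D \<Longrightarrow> t \<notin> set (awalk_verts z p)" for z p y
    using that
  proof (induction p arbitrary: z)
    case (Cons e p)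
    obtain b where e: "e = (z, b)" "(z, b) \<in> parcs T" and p: "apath b p y" "z \<notin> set (awalk_verts b p)"
      using Cons.prems(1) by (cases e) (auto simp: apath_Cons_iff)
    have "b \<in> set (awalk_verts z (e # p))" using hd_in_awalk_verts(2)[OF p(1)] e by simp
    then have "(b, z) \<notin> D" using Cons.prems(2) by blast
    then have zb: "(z, b) \<in> D" using e arcs by blast
    have "set p \<subseteq> D"
    proof (rule Cons.IH[OF p(1)])
      fix t assume "(t, b) \<in> D"
      then have "t = z" using unique zb by blast
      then show "t \<notin> set (awalk_verts b p)" using p(2) by simp
    qed
    then show ?case using zb e by simp
  qed simp
  \<comment> \<open>The bound on \<open>L\<close> guarantees that a path extended by a downward arc
    stays simple.\<close>
  have up: "\<exists>p. apath \<rho> p y \<and> (\<forall>z\<in>set (awalk_verts \<rho> p). L z \<le> L y)" if "y \<in> pverts T" for y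
    using that
  proof (induction "L y" arbitrary: y rule: less_induct)
    case less
    show ?case
    proof (cases "y = \<rho>")
      case True
      then show ?thesis using root by (intro exI[of _ "[]"]) (simp add: apath_Nil_iff)
    next
      case False
      then obtain x where x: "(x, y) \<in> D" using parent less.prems by blast
      then have xy: "(x, y) \<in> parcs T" "x \<in> pverts T" using arcs wf by blast+
      obtain p where p: "apath \<rho> p x" "\<And>z. z \<in> set (awalk_verts \<rho> p) \<Longrightarrow> L z \<le> L x"
        using less.hyps[of x] L[OF x] xy by auto
      have aw: "awalk \<rho> p x" using p(1) by (rule awalkI_apath)
      have step: "awalk x [(x, y)] y" using xy less.prems by (simp add: awalk_simps)
      have set: "set (awalk_verts \<rho> (p @ [(x, y)])) = set (awalk_verts \<rho> p) \<union> {x, y}"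
        using set_awalk_verts_append[OF aw step] by simp
      have last: "awlast \<rho> p = x" using aw by (rule awalkE')
      have "y \<notin> set (awalk_verts \<rho> p)" using p(2)[of y] L[OF x] by auto
      then have "apath \<rho> (p @ [(x, y)]) y"
        unfolding apath_append_iff last using p(1) step L[OF x] by (auto simp: apath_def)
      then show ?thesis using set p(2) L[OF x] by (intro exI[of _ "p @ [(x, y)]"]) fastforce
    qed
  qed
  show ?thesis
  proof (intro set_eqI iffI)
    fix y assume "y \<in> children T \<rho> x"
    then obtain p where "apath \<rho> (p @ [(x, y)]) y" unfolding children_def by auto
    then have "set (p @ [(x, y)]) \<subseteq> D" using root(2) by (intro down) blast+
    then show "y \<in> {y. (x, y) \<in> D}" by simp
  next
    fix y assume "y \<in> {y. (x, y) \<in> D}"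
    then have x: "(x, y) \<in> D" by simp
    then have xy: "(x, y) \<in> parcs T" "x \<in> pverts T" "y \<in> pverts T" using arcs wf by blast+
    obtain p where p: "apath \<rho> p x" "\<And>z. z \<in> set (awalk_verts \<rho> p) \<Longrightarrow> L z \<le> L x"
      using up[OF xy(2)] by blast
    have step: "awalk x [(x, y)] y" using xy by (simp add: awalk_simps)
    have last: "awlast \<rho> p = x" using awalkI_apath[OF p(1)] by (rule awalkE')
    have "y \<notin> set (awalk_verts \<rho> p)" using p(2)[of y] L[OF x] by auto
    then have "apath \<rho> (p @ [(x, y)]) y"
      unfolding apath_append_iff last using p(1) step L[OF x] by (auto simp: apath_def)
    then show "y \<in> children T \<rho> x" unfolding children_def by auto
  qed
qed

context connected_block_graph
begin

abbreviation blk :: "'a set \<Rightarrow> ('a, 'b) bc_node" where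
  "blk K \<equiv> Block (G \<restriction> K)"

lemma induce_eq_iff [simp]: "G \<restriction> K = G \<restriction> L \<longleftrightarrow> K = L"
  using induce_subgraph_verts[of G] by metis

lemma inj_blk: "inj_on blk A"
  by (rule inj_onI) simp

lemma cutpoint_apex:
  assumes "max_clique K"
  shows "cutpoint G (apex K)"
  using cutpoint_iff_child_blocks[OF apex_V[OF assms]] assms unfolding child_blocks_def by blast

definition down_arcs :: "(('a, 'b) bc_node \<times> ('a, 'b) bc_node) set" where
  "down_arcs = {(Cut (apex K), blk K) | K. max_clique K} \<union>
    {(blk K, Cut v) | K v. max_clique K \<and> v \<in> members K \<and> cutpoint G v}"

lemma children_bc_tree: "children (bc_tree G) (Cut r) x = {y. (x, y) \<in> down_arcs}"
proof (rule children_eq_down_arcs)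
  \<comment> \<open>Depth in the tree: one step of \<open>lev\<close> from an apex to a member is
    two steps of the tree, with the block in between.\<close>
  let ?L = "\<lambda>x. case x of Cut v \<Rightarrow> 2 * lev v | Block B \<Rightarrow> Suc (2 * lev (apex (verts B)))"
  have parcs: "parcs (bc_tree G) = (\<Union>(v, K)\<in>{(v, K). cutpoint G v \<and> max_clique K \<and> v \<in> K}.
    {(Cut v, blk K), (blk K, Cut v)})"
    unfolding bc_tree_def block_iff by (auto; blast)
  have in_K: "v \<in> K \<longleftrightarrow> v = apex K \<or> v \<in> members K" if "max_clique K" for v K
    using apex_in[OF that] unfolding members_def by blast
  show "parcs (bc_tree G) \<subseteq> pverts (bc_tree G) \<times> pverts (bc_tree G)"
    unfolding bc_tree_def by auto
  show "parcs (bc_tree G) = down_arcs \<union> down_arcs\<inverse>"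
  proof (intro set_eqI iffI)
    fix e assume "e \<in> parcs (bc_tree G)"
    then obtain v K where vK: "cutpoint G v" "max_clique K" "v \<in> K" "e = (Cut v, blk K) \<or> e = (blk K, Cut v)"
      unfolding parcs by blast
    then show "e \<in> down_arcs \<union> down_arcs\<inverse>"
      using in_K[of K v] unfolding down_arcs_def by blast
  next
    fix e assume "e \<in> down_arcs \<union> down_arcs\<inverse>"
    then obtain v K where "cutpoint G v" "max_clique K" "v \<in> K" "e = (Cut v, blk K) \<or> e = (blk K, Cut v)"
      using cutpoint_apex in_K unfolding down_arcs_def by auto
    then show "e \<in> parcs (bc_tree G)" unfolding parcs by blast
  qed
  show "?L y = Suc (?L x)" if "(x, y) \<in> down_arcs" for x y
    using that members_lev unfolding down_arcs_def by auto
  show "x = x'" if "(x, y) \<in> down_arcs" "(x', y) \<in> down_arcs" for x x' y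
    using that members_home unfolding down_arcs_def by auto
  show "Cut r \<in> pverts (bc_tree G)" unfolding bc_tree_def using cutpoint_r by simp
  show "(x, Cut r) \<notin> down_arcs" for x using members_not_root unfolding down_arcs_def by auto
  show "\<exists>x. (x, y) \<in> down_arcs" if y: "y \<in> pverts (bc_tree G)" "y \<noteq> Cut r" for y
  proof (cases y)
    case (Cut v)
    then have v: "cutpoint G v" "v \<noteq> r" "v \<in> verts G"
      using y unfolding bc_tree_def cutpoint_def by auto
    then have "(blk (home v), Cut v) \<in> down_arcs"
      unfolding down_arcs_def using home_max_clique in_members_home by blast
    then show ?thesis using Cut by blast
  next
    case (Block B)
    then have "block G B" using y unfolding bc_tree_def by auto
    then obtain K where "max_clique K" "B = G \<restriction> K" unfolding block_iff by blast
    then show ?thesis using Block unfolding down_arcs_def by blast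
  qed
qed

lemma children_Cut: "children (bc_tree G) (Cut r) (Cut v) = blk ` child_blocks v"
  unfolding children_bc_tree down_arcs_def child_blocks_def by auto

lemma children_blk:
  assumes "max_clique K"
  shows "children (bc_tree G) (Cut r) (blk K) = Cut ` {u \<in> members K. child_blocks u \<noteq> {}}"
  using assms cutpoint_iff_child_blocks[OF members_V[OF assms]]
  unfolding children_bc_tree down_arcs_def by auto

lemma noncut_weight_blk:
  assumes "max_clique K"
  shows "noncut_weight G w (G \<restriction> K) = (\<Sum>u\<in>{u \<in> members K. child_blocks u = {}}. w u)"
proof -
  have "{u \<in> K. \<not> cutpoint G u} = {u \<in> members K. child_blocks u = {}}"
    using cutpoint_apex[OF assms] cutpoint_iff_child_blocks[OF members_V[OF assms]]
    unfolding members_def by auto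
  then show ?thesis unfolding noncut_weight_def by simp
qed

section \<open>Termination of the recursion on the tree\<close>

abbreviation dom_all :: "('a, 'b) bc_node \<Rightarrow> bool" where
  "dom_all x \<equiv> f1_f2_f3_dom G r (Inl x) \<and> f1_f2_f3_dom G r (Inr (Inl x)) \<and> f1_f2_f3_dom G r (Inr (Inr x))"

text \<open>The three functions call each other on children only. In the domain predicate
  \<open>Inl\<close>, \<open>Inr (Inl _)\<close> and \<open>Inr (Inr _)\<close> tag arguments of
  \<open>f1\<close>, \<open>f2\<close> and \<open>f3\<close>.\<close>

lemma dom_all_step:
  assumes "\<And>y. y \<in> children (bc_tree G) (Cut r) x \<Longrightarrow> dom_all y"

  shows "dom_all x"
proof (cases x)
  case (Cut v)
  let ?C = "children (bc_tree G) (Cut r) (Cut v)"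
  have d: "f1_f2_f3_dom G r (Inl y)" "f1_f2_f3_dom G r (Inr (Inl y))" "f1_f2_f3_dom G r (Inr (Inr y))"
    if "y \<in> ?C" for y using assms(1) that Cut by blast+
  \<comment> \<open>\<open>f3\<close> at a cutpoint is also called at \<open>the_elem\<close>, which
    is known to be a child only if the set of children is a singleton.\<close>
  have e: "f1_f2_f3_dom G r (Inr (Inr (the_elem ?C)))" if "is_singleton ?C"
    using that by (intro d(3)) (auto elim: is_singletonE)
  show ?thesis unfolding Cut
    by (intro conjI f1_f2_f3.domintros) (blast intro: d e)+
next
  case (Block B)
  have d: "f1_f2_f3_dom G r (Inl y)" "f1_f2_f3_dom G r (Inr (Inl y))" "f1_f2_f3_dom G r (Inr (Inr y))"
    if "y \<in> children (bc_tree G) (Cut r) (Block B)" for y using assms(1) that Block by blast+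
  show ?thesis unfolding Block
    by (intro conjI f1_f2_f3.domintros) (blast intro: d)+
qed

lemma dom_all_Cut:
  assumes "v \<in> verts G"
  shows "dom_all (Cut v)"
  using assms
proof (induction "card (below v)" arbitrary: v rule: less_induct)
  case less
  show ?case
  proof (rule dom_all_step)
    fix y assume "y \<in> children (bc_tree G) (Cut r) (Cut v)"
    then obtain K where K: "K \<in> child_blocks v" "y = blk K" unfolding children_Cut by blast
    show "dom_all y" unfolding K(2)
    proof (rule dom_all_step)
      fix z assume "z \<in> children (bc_tree G) (Cut r) (blk K)"
      then obtain u where u: "u \<in> members K" "z = Cut u"
        unfolding children_blk[OF child_blocksD(1)[OF K(1)]] by blast
      show "dom_all z" unfolding u(2)
      proof (rule less.hyps)
        show "card (below u) < card (below v)"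
          by (rule psubset_card_mono[OF finite_below[OF less.prems] below_psubset[OF K(1) u(1)]])
        show "u \<in> verts G" using members_V[OF child_blocksD(1)[OF K(1)] u(1)] .
      qed
    qed
  qed
qed

lemma dom_all_blk:
  assumes K: "max_clique K"
  shows "dom_all (blk K)"
proof (rule dom_all_step)
  fix z assume "z \<in> children (bc_tree G) (Cut r) (blk K)"
  then obtain u where u: "u \<in> members K" "z = Cut u" unfolding children_blk[OF K] by blast
  show "dom_all z" unfolding u(2) by (rule dom_all_Cut[OF members_V[OF K u(1)]])
qed

section \<open>The recursion read at vertices and maximal cliques\<close>

lemma sum_blk: "sum f (blk ` A) = (\<Sum>K\<in>A. f (blk K))"
  by (simp add: sum.reindex[OF inj_blk])

lemma sum_Cut: "sum f (Cut ` A) = (\<Sum>v\<in>A. f (Cut v))"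
  by (simp add: sum.reindex inj_on_def)

lemma image_blk_diff: "blk ` A - {blk a, blk b} = blk ` (A - {a, b})" "blk ` A - {blk a} = blk ` (A - {a})"
  by auto

lemma image_Cut_diff: "Cut ` A - {Cut a} = Cut ` (A - {a})"
  by auto

lemma f1_Cut:
  assumes "v \<in> verts G"
  shows "f1 G w r (Cut v) = w v + (\<Sum>K\<in>child_blocks v. f2 G w r (blk K))"
  using dom_all_Cut[OF assms] by (simp add: f1.psimps children_Cut sum_blk)

lemma f2_Cut:
  assumes "v \<in> verts G"
  shows "f2 G w r (Cut v) = (if card (child_blocks v) \<le> 2 then \<Sum>K\<in>child_blocks v. f3 G w r (blk K)
    else MIN a\<in>child_blocks v. MIN b\<in>child_blocks v.
      (\<Sum>K\<in>{a, b}. f3 G w r (blk K)) + (\<Sum>K\<in>child_blocks v - {a, b}. f1 G w r (blk K)))"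
proof -
  have pair: "sum f {blk a, blk b} = (\<Sum>K\<in>{a, b}. f (blk K))" for f :: "('a, 'b) bc_node \<Rightarrow> nat" and a b
    using sum_blk[of f "{a, b}"] by simp
  show ?thesis
    using dom_all_Cut[OF assms]
    unfolding f2.psimps(1)[OF dom_all_Cut[OF assms, THEN conjunct2, THEN conjunct1]] children_Cut
      card_image[OF inj_blk] sum_blk image_image pair image_blk_diff(1) by simp
qed

lemma f3_Cut:
  assumes "v \<in> verts G"
  shows "f3 G w r (Cut v) =
    (if is_singleton (child_blocks v) then f3 G w r (blk (the_elem (child_blocks v)))
     else MIN a\<in>child_blocks v. f3 G w r (blk a) + (\<Sum>K\<in>child_blocks v - {a}. f1 G w r (blk K)))"
proof -
  have sing: "is_singleton (blk ` child_blocks v) \<longleftrightarrow> is_singleton (child_blocks v)"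
    unfolding is_singleton_altdef card_image[OF inj_blk] ..
  have elem: "the_elem (blk ` child_blocks v) = blk (the_elem (child_blocks v))" if "is_singleton (child_blocks v)"
    using that by (elim is_singletonE) simp
  show ?thesis
    unfolding f3.psimps(1)[OF dom_all_Cut[OF assms, THEN conjunct2, THEN conjunct2]] children_Cut
      sing sum_blk image_image image_blk_diff(2) using elem by simp
qed

context
  fixes K assumes K: "max_clique K"
begin

text \<open>For \<open>f1\<close> and \<open>f3\<close> the case without children merges into the
  general one, an empty sum being 0. For \<open>f2\<close> it stays, since a minimum over no
  children has no meaning.\<close>

lemma f1_blk:
  "f1 G w r (blk K) = (\<Sum>u\<in>{u \<in> members K. child_blocks u = {}}. w u) +
    (\<Sum>u\<in>{u \<in> members K. child_blocks u \<noteq> {}}. f1 G w r (Cut u))"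
  unfolding f1.psimps(2)[OF dom_all_blk[OF K, THEN conjunct1]] children_blk[OF K] sum_Cut
    noncut_weight_blk[OF K] image_is_empty by (auto intro!: sum.neutral)

lemma f2_blk:
  "f2 G w r (blk K) = (if {u \<in> members K. child_blocks u \<noteq> {}} = {} then 0
    else min (\<Sum>u\<in>{u \<in> members K. child_blocks u \<noteq> {}}. min (f1 G w r (Cut u)) (f3 G w r (Cut u)))
      (MIN v\<in>{u \<in> members K. child_blocks u \<noteq> {}}.
        (\<Sum>u\<in>{u \<in> members K. child_blocks u = {}}. w u) + f2 G w r (Cut v) +
        (\<Sum>u\<in>{u \<in> members K. child_blocks u \<noteq> {}} - {v}. f1 G w r (Cut u))))"
  unfolding f2.psimps(2)[OF dom_all_blk[OF K, THEN conjunct2, THEN conjunct1]] children_blk[OF K] sum_Cut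
    noncut_weight_blk[OF K] image_image image_Cut_diff image_is_empty ..

lemma f3_blk:
  "f3 G w r (blk K) =
    (\<Sum>u\<in>{u \<in> members K. child_blocks u \<noteq> {}}. min (f1 G w r (Cut u)) (f3 G w r (Cut u)))"
  unfolding f3.psimps(2)[OF dom_all_blk[OF K, THEN conjunct2, THEN conjunct2]] children_blk[OF K] sum_Cut
    image_is_empty by (auto intro!: sum.neutral)

end

lemma min_claw_deletion_set:
  "min (f1 G w r (Cut r)) (f2 G w r (Cut r)) = (MIN S\<in>{S. claw_deletion_set G S}. \<Sum>u\<in>S. w u)"
proof -
  have "child_blocks r \<noteq> {}" using cutpoint_iff_child_blocks[OF r_in] cutpoint_r by simp
  then have "attains w {S. S \<subseteq> verts G \<and> (\<forall>v\<in>verts G. claw_free_at v S)}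
    (min (f1 G w r (Cut r)) (f2 G w r (Cut r)))"
    \<comment> \<open>The nodes \<open>Cut v\<close> and \<open>blk K\<close> supply the abstract
      values; \<open>rotated -1\<close> brings the premise on \<open>r\<close> to the front, where
      the chained fact meets it.\<close>
    by (rule attains_claw_free[where ?g1.0 = "\<lambda>v. f1 G w r (Cut v)" and ?g2.0 = "\<lambda>v. f2 G w r (Cut v)" and ?g3.0 = "\<lambda>v. f3 G w r (Cut v)" and ?h1.0 = "\<lambda>K. f1 G w r (blk K)"
        and ?h2.0 = "\<lambda>K. f2 G w r (blk K)" and ?h3.0 = "\<lambda>K. f3 G w r (blk K)", rotated -1])
      (rule f1_Cut f2_Cut f3_Cut f1_blk f2_blk f3_blk, assumption)+
  then have att: "attains w {S. claw_deletion_set G S} (min (f1 G w r (Cut r)) (f2 G w r (Cut r)))"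
    unfolding claw_deletion_set_iff .
  have "{S. claw_deletion_set G S} \<subseteq> Pow (verts G)" unfolding claw_deletion_set_def by blast
  then have "finite {S. claw_deletion_set G S}" by (rule finite_subset) simp
  then show ?thesis using att unfolding attains_def by (intro Min_eqI[symmetric]) (auto intro: rev_image_eqI)
qed

end

theorem theorem4:
  fixes G :: "('a,'b) pre_digraph" and w :: "'a \<Rightarrow> nat" and r :: 'a
  assumes "block_graph G"
    and "Digraph_Component.connected G"
    and "\<not> complete_graph G"
    and "\<forall>v\<in>verts G. w v > 0"
    and "cutpoint G r"
  shows "min (f1 G w r (Cut r)) (f2 G w r (Cut r)) =
    (MIN S\<in>{S. claw_deletion_set G S}. \<Sum>u\<in>S. w u)"
proof -
  interpret graph G using assms(1) unfolding block_graph_def by blast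
  interpret connected_block_graph G r using assms by unfold_locales
  show ?thesis by (rule min_claw_deletion_set)
qed

end
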